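(* For every $a\in\mathcal V^{\mathrm{DR}}$ the following equality holds in $\big(\mathcal V^{\mathrm{DR}}[\tfrac1{e_1}]_{\ge0}\big)^{\otimes2}$: $$\Delta^{\mathcal W,\mathrm{DR}}(a\,e_1)=(e_1f_1)^{-1}\,\mathrm{row}_1\cdot\rho(a)\cdot\mathrm{col}_1\,e_1f_1,$$ where the left-hand side is viewed in $\big(\mathcal V^{\mathrm{DR}}[\tfrac1{e_1}]_{\ge0}\big)^{\otimes2}$ through the tensor square of the inclusion $\mathcal W^{\mathrm{DR}}\hookrightarrow\mathcal V^{\mathrm{DR}}\hookrightarrow\mathcal V^{\mathrm{DR}}[\tfrac1{e_1}]_{\ge0}$. Equivalently, the diagram with the two compositions $$\mathcal V^{\mathrm{DR}}\xrightarrow{\ \rho\ }M_3((\mathcal V^{\mathrm{DR}})^{\otimes2})\xrightarrow{\ (e_1f_1)^{-1}\mathrm{row}_1\cdot(-)\cdot\mathrm{col}_1e_1f_1\ }\big(\mathcal V^{\mathrm{DR}}[\tfrac1{e_1}]_{\ge0}\big)^{\otimes2},$$ $$\mathcal V^{\mathrm{DR}}\xrightarrow{\ \mathrm{id}\ }(\mathcal V^{\mathrm{DR}},\cdot_{e_1})\xrightarrow{\ \mathrm{mor}\ }\mathcal W^{\mathrm{DR}}_+\xrightarrow{\ \Delta^{\mathcal W,\mathrm{DR}}\ }(\mathcal W^{\mathrm{DR}})^{\otimes2}\hookrightarrow\big(\mathcal V^{\mathrm{DR}}[\tfrac1{e_1}]_{\ge0}\big)^{\otimes2}$$ commutes. Moreover,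 in this diagram all the maps are algebra morphisms, except for $\mathrm{id}:\mathcal V^{\mathrm{DR}}\to(\mathcal V^{\mathrm{DR}},\cdot_{e_1})$ and $(e_1f_1)^{-1}\mathrm{row}_1\cdot(-)\cdot\mathrm{col}_1e_1f_1$, which are only $\mathbf k$-module morphisms; and all the maps have degree $0$, except for $\mathrm{mor}$ (which is an isomorphism) and $(e_1f_1)^{-1}\mathrm{row}_1\cdot(-)\cdot\mathrm{col}_1e_1f_1$, which have degree $1$.
   Context: $\mathbf k$ is a commutative $\mathbb Q$-algebra. $\mathcal V^{\mathrm{DR}}:=\mathbf k\langle e_0,e_1\rangle$ is the free associative unital algebra, graded by $\deg e_0=\deg e_1=1$; $e_\infty:=-e_0-e_1$. In $(\mathcal V^{\mathrm{DR}})^{\otimes2}$ one writes $e_i:=e_i\otimes1$, $f_i:=1\otimes e_i$. $\mathcal W^{\mathrm{DR}}:=\mathbf k\oplus\mathcal V^{\mathrm{DR}}e_1$, a subalgebra freely generated by $y_n:=-e_0^{n-1}e_1$ ($n\ge1$), and $\mathcal W^{\mathrm{DR}}_+:=\mathcal V^{\mathrm{DR}}e_1$. $\Delta^{\mathcal W,\mathrm{DR}}:\mathcal W^{\mathrm{DR}}\to(\mathcal W^{\mathrm{DR}})^{\otimes2}$ is the algebra morphism with $y_n\mapsto y_n\otimes1+1\otimes y_n+\sum_{k=1}^{n-1}y_k\otimes y_{n-k}$. $(\mathcal V^{\mathrm{DR}},\cdot_{e_1})$ is the module $\mathcal V^{\mathrm{DR}}$ with (non-unital) product $a\cdot_{e_1}b:=ae_1b$,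 and $\mathrm{mor}:(\mathcal V^{\mathrm{DR}},\cdot_{e_1})\to\mathcal W^{\mathrm{DR}}_+$ is $a\mapsto ae_1$. $\mathcal V^{\mathrm{DR}}[\frac1{e_1}]$ is the $\mathbb Z$-graded algebra with generators $e_0,e_1^{\pm1}$ and relations $e_1e_1^{-1}=e_1^{-1}e_1=1$; the index $\ge0$ denotes its part of degrees $\ge0$. $\mathfrak p_5$ is the graded Lie algebra over $\mathbf k$ with generators $e_{ij}$ ($i\ne j\in\{1,\dots,5\}$) of degree 1 and relations $e_{ij}=e_{ji}$, $\sum_{j\ne i}e_{ij}=0$ for each $i$, $[e_{ij},e_{kl}]=0$ for $i,j,k,l$ distinct. The following are algebra morphisms induced by Lie algebra morphisms: $\ell:\mathcal V^{\mathrm{DR}}\to U\mathfrak p_5$, $e_0\mapsto e_{23}$, $e_1\mapsto e_{12}$; and $\mathrm{pr}_1,\mathrm{pr}_2,\mathrm{pr}_5:U\mathfrak p_5\to\mathcal V^{\mathrm{DR}}$ given by: $\mathrm{pr}_1$ kills all $e_{1j}$ and maps $e_{23},e_{45}\mapsto e_0$, $e_{25},e_{34}\mapsto e_1$, $e_{24},e_{35}\mapsto e_\infty$; $\mathrm{pr}_2$ kills all $e_{2j}$ and maps $e_{14},e_{35}\mapsto e_0$, $e_{15},e_{34}\mapsto e_1$, $e_{13},e_{45}\mapsto e_\infty$; $\mathrm{pr}_5$ kills all $e_{j5}$ and maps $e_{14},e_{23}\mapsto e_0$, $e_{12},e_{34}\mapsto e_1$, $e_{13},e_{24}\mapsto e_\infty$.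 $\mathrm{pr}_{12}:U\mathfrak p_5\to(\mathcal V^{\mathrm{DR}})^{\otimes2}$ is the algebra morphism with $x\mapsto\mathrm{pr}_1(x)\otimes1+1\otimes\mathrm{pr}_2(x)$ for $x\in\mathfrak p_5$. The two-sided ideal $J(\mathrm{pr}_5):=\mathrm{Ker}(\mathrm{pr}_5)$ of $U\mathfrak p_5$ is free as a left $U\mathfrak p_5$-module with basis $(e_{15},e_{25},e_{35})$; hence for $p\in U\mathfrak p_5$ there is a unique matrix $\varpi(p)=(a_{ij}(p))_{1\le i,j\le3}$ with $e_{i5}p=\sum_{j=1}^3a_{ij}(p)e_{j5}$ for $i=1,2,3$, and $\varpi:U\mathfrak p_5\to M_3(U\mathfrak p_5)$ is an algebra morphism. The algebra morphism $\rho:\mathcal V^{\mathrm{DR}}\to M_3((\mathcal V^{\mathrm{DR}})^{\otimes2})$ is $\rho:=M_3(\mathrm{pr}_{12})\circ\varpi\circ\ell$, where $M_3(\mathrm{pr}_{12})$ applies $\mathrm{pr}_{12}$ entrywise. Finally $$\mathrm{row}_1:=\begin{pmatrix}e_1&-f_1&0\end{pmatrix},\qquad\mathrm{col}_1:=\begin{pmatrix}1\\-1\\0\end{pmatrix}$$ with entries in $(\mathcal V^{\mathrm{DR}})^{\otimes2}$. *)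

theory Defs
  imports "HOL-Analysis.Analysis" "HOL-Library.Poly_Mapping"
begin

section \<open>Morphisms, degrees, Q-algebras\<close>

text \<open>
  A \<open>k\<close>-algebra is a ring type together with an explicit scalar multiplication \<open>s\<close>; subalgebras and
  submodules are sets. Multiplications are passed explicitly, because one module can carry several
  products and because \<open>(*)\<close> on matrices is the entrywise product, not \<open>(**)\<close>.
\<close>

definition module_mor ::
  "('k \<Rightarrow> 'a \<Rightarrow> 'a::ab_group_add) \<Rightarrow> ('k \<Rightarrow> 'b \<Rightarrow> 'b::ab_group_add) \<Rightarrow>
   'a set \<Rightarrow> 'b set \<Rightarrow> ('a \<Rightarrow> 'b) \<Rightarrow> bool" where
  "module_mor s t A B f \<longleftrightarrow>
     f ` A \<subseteq> B \<and>
     (\<forall>x\<in>A. \<forall>y\<in>A. f (x + y) = f x + f y) \<and>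
     (\<forall>c. \<forall>x\<in>A. f (s c x) = t c (f x))"

definition mult_mor ::
  "('a \<Rightarrow> 'a \<Rightarrow> 'a) \<Rightarrow> ('b \<Rightarrow> 'b \<Rightarrow> 'b) \<Rightarrow> 'a set \<Rightarrow> ('a \<Rightarrow> 'b) \<Rightarrow> bool" where
  "mult_mor m n A f \<longleftrightarrow> (\<forall>x\<in>A. \<forall>y\<in>A. f (m x y) = n (f x) (f y))"

text \<open>\<open>alg_mor\<close> does not ask for units, so that it also applies to algebras without unit.\<close>

definition alg_mor ::
  "('k \<Rightarrow> 'a \<Rightarrow> 'a::ab_group_add) \<Rightarrow> ('a \<Rightarrow> 'a \<Rightarrow> 'a) \<Rightarrow>
   ('k \<Rightarrow> 'b \<Rightarrow> 'b::ab_group_add) \<Rightarrow> ('b \<Rightarrow> 'b \<Rightarrow> 'b) \<Rightarrow>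
   'a set \<Rightarrow> 'b set \<Rightarrow> ('a \<Rightarrow> 'b) \<Rightarrow> bool" where
  "alg_mor s m t n A B f \<longleftrightarrow> module_mor s t A B f \<and> mult_mor m n A f"

definition has_degree ::
  "int \<Rightarrow> (int \<Rightarrow> 'a set) \<Rightarrow> (int \<Rightarrow> 'b set) \<Rightarrow> ('a \<Rightarrow> 'b) \<Rightarrow> bool" where
  "has_degree d A B f \<longleftrightarrow> (\<forall>n. f ` A n \<subseteq> B (n + d))"

definition rat_algebra_map :: "(rat \<Rightarrow> 'k::comm_ring_1) \<Rightarrow> bool" where
  "rat_algebra_map h \<longleftrightarrow>
     h 1 = 1 \<and> (\<forall>x y. h (x + y) = h x + h y) \<and> (\<forall>x y. h (x * y) = h x * h y)"


section \<open>Monoid algebras and free algebras\<close>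

text \<open>
  For a (not necessarily commutative) additively written monoid \<open>'m\<close>, the ring
  \<open>'m \<Rightarrow>\<^sub>0 'k\<close> with the convolution product is the monoid algebra of \<open>'m\<close> over \<open>'k\<close>. The free
  algebra on a set of generators is the monoid algebra of the monoid of words.
\<close>

definition kscale :: "'k::comm_ring_1 \<Rightarrow> ('m \<Rightarrow>\<^sub>0 'k) \<Rightarrow> ('m \<Rightarrow>\<^sub>0 'k)" where
  "kscale c x = Poly_Mapping.map ((*) c) x"

lemma kscale_conv_mult: "kscale c x = Poly_Mapping.single 0 c * x"
  by (simp add: kscale_def mult_map_scale_conv_mult)

lemma pm_induct:
  fixes x :: "'m \<Rightarrow>\<^sub>0 'k::comm_monoid_add"
  assumes "P 0" "\<And>u c. P (Poly_Mapping.single u c)" "\<And>x z. P x \<Longrightarrow> P z \<Longrightarrow> P (x + z)"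
  shows "P x"
proof -
  have "P (\<Sum>u\<in>A. Poly_Mapping.single u (Poly_Mapping.lookup x u))" if "finite A" for A
    using that assms by induction auto
  moreover have "(\<Sum>u\<in>Poly_Mapping.keys x. Poly_Mapping.single u (Poly_Mapping.lookup x u)) = x"
    by (rule poly_mapping_eqI) (simp add: lookup_sum lookup_single when_def in_keys_iff)
  ultimately show ?thesis
    by (metis finite_keys)
qed

lemma lookup_kscale: "Poly_Mapping.lookup (kscale c x) m = c * Poly_Mapping.lookup x m"
  by (simp add: kscale_def map.rep_eq when_def)

lemma module_kscale: "module kscale"
  by standard (auto intro!: poly_mapping_eqI simp: lookup_kscale lookup_add algebra_simps)

lemma kscale_single: "kscale c (Poly_Mapping.single m d) = Poly_Mapping.single m (c * d)"
  by (rule poly_mapping_eqI) (simp add: lookup_kscale lookup_single when_def)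

lemma kscale_mult_left: "kscale c x * z = kscale c (x * z)"
  by (simp add: kscale_conv_mult mult.assoc)

lemma kscale_mult_right: "x * kscale c z = kscale c (x * z)"
proof (induction x rule: pm_induct)
  case (2 u d)
  show ?case
  proof (induction z rule: pm_induct)
    case (3 x z)
    then show ?case by (simp add: distrib_left module.scale_right_distrib[OF module_kscale])
  qed (simp_all add: kscale_single mult_single mult_ac module.scale_zero_right[OF module_kscale])
qed (simp_all add: distrib_right module.scale_right_distrib[OF module_kscale] module.scale_zero_right[OF module_kscale])

locale k_algebra =
  fixes s :: "'k::comm_ring_1 \<Rightarrow> 'b \<Rightarrow> 'b::ring_1"
  assumes mod: "module s"
    and left: "s c x * z = s c (x * z)"
    and right: "x * s c z = s c (x * z)"

interpretation kscale_algebra: k_algebra kscale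
  by standard
    (auto intro!: poly_mapping_eqI
      simp: lookup_kscale lookup_add algebra_simps kscale_mult_left kscale_mult_right)

text \<open>The linear map with prescribed values on the basis of a monoid algebra.\<close>

definition linear_lift ::
  "('k \<Rightarrow> 'b \<Rightarrow> 'b) \<Rightarrow> ('m \<Rightarrow> 'b) \<Rightarrow> ('m \<Rightarrow>\<^sub>0 'k::comm_ring_1) \<Rightarrow> 'b::ab_group_add" where
  "linear_lift s f x = (\<Sum>m\<in>Poly_Mapping.keys x. s (Poly_Mapping.lookup x m) (f m))"

context module
begin

lemma linear_lift_on:
  assumes "finite S" "Poly_Mapping.keys x \<subseteq> S"
  shows "linear_lift scale f x = (\<Sum>m\<in>S. scale (Poly_Mapping.lookup x m) (f m))"
  unfolding linear_lift_def using assms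
  by (intro sum.mono_neutral_left) (auto simp: in_keys_iff)

lemma linear_lift_add: "linear_lift scale f (x + z) = linear_lift scale f x + linear_lift scale f z"
  unfolding linear_lift_on[of "Poly_Mapping.keys x \<union> Poly_Mapping.keys z", OF _ keys_add, simplified]
    linear_lift_on[of "Poly_Mapping.keys x \<union> Poly_Mapping.keys z" x, simplified]
    linear_lift_on[of "Poly_Mapping.keys x \<union> Poly_Mapping.keys z" z, simplified]
  by (simp add: lookup_add scale_left_distrib sum.distrib)

lemma linear_lift_single: "linear_lift scale f (Poly_Mapping.single m c) = scale c (f m)"
  by (simp add: linear_lift_on[of "{m}"])

lemma linear_lift_zero: "linear_lift scale f 0 = 0"
  by (simp add: linear_lift_def)

lemma linear_lift_kscale: "linear_lift scale f (kscale c x) = scale c (linear_lift scale f x)"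
proof (induction x rule: pm_induct)
  case (3 x z)
  then show ?case
    by (simp add: linear_lift_add module.scale_right_distrib[OF module_kscale] scale_right_distrib)
qed (simp_all add: linear_lift_zero linear_lift_single kscale_single
      module.scale_zero_right[OF module_kscale])

lemma linear_lift_unique:
  assumes "\<And>x z. g (x + z) = g x + g z" "\<And>c x. g (kscale c x) = scale c (g x)"
    and "\<And>m. g (Poly_Mapping.single m 1) = f m"
  shows "g = linear_lift scale f"
proof
  fix x
  show "g x = linear_lift scale f x"
  proof (induction x rule: pm_induct)
    case 1
    show ?case using assms(1)[of 0 0] by (simp add: linear_lift_zero)
  next
    case (2 u c)
    show ?case using assms(2)[of c "Poly_Mapping.single u 1"]
      by (simp add: kscale_single assms(3) linear_lift_single)
  qed (simp add: assms(1) linear_lift_add)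
qed

end

lemma (in k_algebra) linear_lift_mult:
  fixes f :: "'m::monoid_add \<Rightarrow> 'b"
  assumes "\<And>u v. f (u + v) = f u * f v"
  shows "linear_lift s f (x * z) = linear_lift s f x * linear_lift s f z"
proof (induction x rule: pm_induct)
  case (2 u d)
  show ?case
  proof (induction z rule: pm_induct)
    case (2 v c)
    show ?case
      by (simp add: mult_single module.linear_lift_single[OF mod] assms left right
          module.scale_scale[OF mod] mult.commute)
  qed (simp_all add: module.linear_lift_zero[OF mod] module.linear_lift_add[OF mod] distrib_left)
qed (simp_all add: module.linear_lift_zero[OF mod] module.linear_lift_add[OF mod] distrib_right)

datatype 'x word = Word (letters: "'x list")

instantiation word :: (type) monoid_add
begin

definition zero_word :: "'x word" where "zero_word = Word []"

definition plus_word :: "'x word \<Rightarrow> 'x word \<Rightarrow> 'x word" where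
  "plus_word u v = Word (letters u @ letters v)"

instance
  by standard (simp_all add: zero_word_def plus_word_def)

end

definition gen :: "'x \<Rightarrow> ('x word \<Rightarrow>\<^sub>0 'k::comm_ring_1)" where
  "gen x = Poly_Mapping.single (Word [x]) 1"

text \<open>The algebra morphism from the free algebra to the algebra \<open>('b, s)\<close> with \<open>gen x \<mapsto> f x\<close>.\<close>

definition free_lift ::
  "('k \<Rightarrow> 'b \<Rightarrow> 'b) \<Rightarrow> ('x \<Rightarrow> 'b) \<Rightarrow> ('x word \<Rightarrow>\<^sub>0 'k::comm_ring_1) \<Rightarrow> 'b::ring_1" where
  "free_lift s f = linear_lift s (\<lambda>w. prod_list (map f (letters w)))"

context k_algebra
begin

lemma free_lift_add: "free_lift s f (x + z) = free_lift s f x + free_lift s f z"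
  by (simp add: free_lift_def module.linear_lift_add[OF mod])

lemma free_lift_zero: "free_lift s f 0 = 0"
  by (simp add: free_lift_def module.linear_lift_zero[OF mod])

lemma free_lift_kscale: "free_lift s f (kscale c x) = s c (free_lift s f x)"
  by (simp add: free_lift_def module.linear_lift_kscale[OF mod])

lemma free_lift_mult: "free_lift s f (x * z) = free_lift s f x * free_lift s f z"
  unfolding free_lift_def by (rule linear_lift_mult) (simp add: plus_word_def)

lemma free_lift_gen: "free_lift s f (gen x) = f x"
  by (simp add: free_lift_def gen_def module.linear_lift_single[OF mod] module.scale_one[OF mod])

lemma free_lift_one: "free_lift s f 1 = 1"
  using module.linear_lift_single[OF mod, of "\<lambda>w. prod_list (map f (letters w))" 0 1]
  by (simp only: single_one free_lift_def) (simp add: zero_word_def module.scale_one[OF mod])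

lemma free_lift_diff: "free_lift s f (x - z) = free_lift s f x - free_lift s f z"
  by (metis add_diff_cancel diff_add_cancel free_lift_add)

lemma free_lift_unique:
  assumes "\<And>x z. g (x + z) = g x + g z" "\<And>c x. g (kscale c x) = s c (g x)"
    "\<And>x z. g (x * z) = g x * g z" "g 1 = 1" "\<And>x. g (gen x) = f x"
  shows "g = free_lift s f"
proof -
  have "g (Poly_Mapping.single (Word l) 1) = prod_list (map f l)" for l
  proof (induction l)
    case Nil
    then show ?case using assms(4) by (simp flip: zero_word_def)
  next
    case (Cons a l)
    have "Poly_Mapping.single (Word (a # l)) 1 = gen a * Poly_Mapping.single (Word l) (1::'k)"
      by (simp add: gen_def mult_single plus_word_def)
    with Cons show ?case by (simp add: assms)
  qed
  then have "g (Poly_Mapping.single w 1) = prod_list (map f (letters w))" for w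
    by (cases w) simp
  from module.linear_lift_unique[OF mod assms(1,2) this] show ?thesis
    by (simp add: free_lift_def fun_eq_iff)
qed

end

definition graded_part :: "('m \<Rightarrow> int) \<Rightarrow> int \<Rightarrow> ('m \<Rightarrow>\<^sub>0 'k::zero) set" where
  "graded_part d n = {x. \<forall>m\<in>Poly_Mapping.keys x. d m = n}"

text \<open>
  The tensor product of the monoid algebras of \<open>'m\<close> and \<open>'n\<close> is the monoid algebra of the
  product monoid, the pure tensor of basis elements \<open>u\<close> and \<open>v\<close> being the basis element \<open>(u, v)\<close>;
  its universal property is \<open>tensor_universal\<close> below.
\<close>

definition tensor :: "('m \<Rightarrow>\<^sub>0 'k) \<Rightarrow> ('n \<Rightarrow>\<^sub>0 'k) \<Rightarrow> ('m \<times> 'n \<Rightarrow>\<^sub>0 'k::comm_ring_1)"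
  (infixr \<open>\<otimes>\<^sub>t\<close> 75) where
  "x \<otimes>\<^sub>t y =
     (\<Sum>u\<in>Poly_Mapping.keys x. \<Sum>v\<in>Poly_Mapping.keys y.
        Poly_Mapping.single (u, v) (Poly_Mapping.lookup x u * Poly_Mapping.lookup y v))"

lemma lookup_tensor:
  "Poly_Mapping.lookup (x \<otimes>\<^sub>t z) (u, v) = Poly_Mapping.lookup x u * Poly_Mapping.lookup z v"
proof -
  have "Poly_Mapping.lookup (x \<otimes>\<^sub>t z) (u, v) =
     (\<Sum>u'\<in>Poly_Mapping.keys x. if u' = u then
       (\<Sum>v'\<in>Poly_Mapping.keys z. if v' = v then Poly_Mapping.lookup x u * Poly_Mapping.lookup z v else 0) else 0)"
    unfolding tensor_def lookup_sum
    by (intro sum.cong refl) (auto simp: lookup_single when_def intro!: sum.cong)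
  then show ?thesis
    by (simp add: in_keys_iff)
qed


lemma tensor_add_left: "(x + x') \<otimes>\<^sub>t z = x \<otimes>\<^sub>t z + x' \<otimes>\<^sub>t z"
  by (rule poly_mapping_eqI) (auto simp: lookup_tensor lookup_add algebra_simps split: prod.splits)

lemma tensor_add_right: "x \<otimes>\<^sub>t (z + z') = x \<otimes>\<^sub>t z + x \<otimes>\<^sub>t z'"
  by (rule poly_mapping_eqI) (auto simp: lookup_tensor lookup_add algebra_simps split: prod.splits)

lemma tensor_kscale_left: "kscale c x \<otimes>\<^sub>t z = kscale c (x \<otimes>\<^sub>t z)"
  by (rule poly_mapping_eqI) (auto simp: lookup_tensor lookup_kscale algebra_simps)

lemma tensor_kscale_right: "x \<otimes>\<^sub>t kscale c z = kscale c (x \<otimes>\<^sub>t z)"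
  by (rule poly_mapping_eqI) (auto simp: lookup_tensor lookup_kscale algebra_simps)

lemma tensor_zero: "0 \<otimes>\<^sub>t z = 0" "x \<otimes>\<^sub>t 0 = 0"
  by (auto intro!: poly_mapping_eqI simp: lookup_tensor)

lemma tensor_single:
  "Poly_Mapping.single u a \<otimes>\<^sub>t Poly_Mapping.single v b = Poly_Mapping.single (u, v) (a * b)"
  by (rule poly_mapping_eqI) (auto simp: lookup_tensor lookup_single when_def split: if_splits)

lemma tensor_mult:
  fixes x x' :: "'m::monoid_add \<Rightarrow>\<^sub>0 'k::comm_ring_1" and z z' :: "'n::monoid_add \<Rightarrow>\<^sub>0 'k"
  shows "(x \<otimes>\<^sub>t z) * (x' \<otimes>\<^sub>t z') = (x * x') \<otimes>\<^sub>t (z * z')"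
proof (induction x rule: pm_induct)
  case (2 u a)
  show ?case
  proof (induction x' rule: pm_induct)
    case (2 u' a')
    show ?case
    proof (induction z rule: pm_induct)
      case (2 v b)
      show ?case
      proof (induction z' rule: pm_induct)
        case (2 v' b')
        show ?case by (simp add: tensor_single mult_single mult_ac)
      qed (simp_all add: tensor_zero tensor_add_right distrib_left)
    qed (simp_all add: tensor_zero tensor_add_right distrib_left distrib_right)
  qed (simp_all add: tensor_zero tensor_add_left distrib_left)
qed (simp_all add: tensor_zero tensor_add_left distrib_right)

lemma tensor_one: "1 \<otimes>\<^sub>t 1 = 1"
  using tensor_single[of 0 1 0 1] by (simp flip: zero_prod_def)

theorem tensor_universal:
  fixes s :: "'k::comm_ring_1 \<Rightarrow> 'b \<Rightarrow> 'b::ab_group_add"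
    and B :: "('m \<Rightarrow>\<^sub>0 'k) \<Rightarrow> ('n \<Rightarrow>\<^sub>0 'k) \<Rightarrow> 'b"
  assumes "module s"
    and "\<And>x x' z. B (x + x') z = B x z + B x' z" "\<And>x z z'. B x (z + z') = B x z + B x z'"
    and "\<And>c x z. B (kscale c x) z = s c (B x z)" "\<And>c x z. B x (kscale c z) = s c (B x z)"
  shows "\<exists>!L. (\<forall>x z. L (x + z) = L x + L z) \<and> (\<forall>c x. L (kscale c x) = s c (L x)) \<and>
    (\<forall>x z. L (x \<otimes>\<^sub>t z) = B x z)"
proof -
  interpret module s by fact
  let ?f = "\<lambda>(u, v). B (Poly_Mapping.single u 1) (Poly_Mapping.single v 1)"
  let ?L = "linear_lift s ?f"
  have B0: "B 0 z = 0" "B x 0 = 0" for x z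
    using assms(2)[of 0 0] assms(3)[of _ 0 0] by simp_all
  have B1: "B (Poly_Mapping.single u a) z = s a (B (Poly_Mapping.single u 1) z)" for u a z
    by (simp add: kscale_single flip: assms(4))
  have B2: "B x (Poly_Mapping.single v a) = s a (B x (Poly_Mapping.single v 1))" for v a x
    by (simp add: kscale_single flip: assms(5))
  have L: "?L (x \<otimes>\<^sub>t z) = B x z" for x z
  proof (induction x rule: pm_induct)
    case (2 u a)
    show ?case
    proof (induction z rule: pm_induct)
      case (2 v b)
      show ?case
        by (simp only: B1[of u a] B2[of _ v b] tensor_single linear_lift_single scale_scale
            prod.case mult.commute)
    qed (simp_all add: tensor_zero linear_lift_zero B0 tensor_add_right linear_lift_add assms)
  qed (simp_all add: tensor_zero linear_lift_zero B0 tensor_add_left linear_lift_add assms)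
  show ?thesis
  proof (rule ex1I[of _ ?L], intro conjI allI)
    fix L assume *: "(\<forall>x z. L (x + z) = L x + L z) \<and> (\<forall>c x. L (kscale c x) = s c (L x)) \<and>
      (\<forall>x z. L (x \<otimes>\<^sub>t z) = B x z)"
    have "L (Poly_Mapping.single m 1) = ?f m" for m
    proof (cases m)
      case (Pair u v)
      have "L (Poly_Mapping.single m 1) = L (Poly_Mapping.single u 1 \<otimes>\<^sub>t Poly_Mapping.single v 1)"
        by (simp add: Pair tensor_single)
      also have "\<dots> = ?f m"
        using * by (simp only: Pair prod.case)
      finally show ?thesis .
    qed
    with * show "L = ?L" by (intro linear_lift_unique) auto
  qed (auto simp: linear_lift_add linear_lift_kscale L)
qed

definition tensor_map ::
  "(('m \<Rightarrow>\<^sub>0 'k) \<Rightarrow> ('p \<Rightarrow>\<^sub>0 'k)) \<Rightarrow> (('n \<Rightarrow>\<^sub>0 'k) \<Rightarrow> ('q \<Rightarrow>\<^sub>0 'k)) \<Rightarrow>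
   ('m \<times> 'n \<Rightarrow>\<^sub>0 'k) \<Rightarrow> ('p \<times> 'q \<Rightarrow>\<^sub>0 'k::comm_ring_1)" where
  "tensor_map f g = linear_lift kscale
     (\<lambda>(u, v). f (Poly_Mapping.single u 1) \<otimes>\<^sub>t g (Poly_Mapping.single v 1))"

text \<open>
  The tensor square of a submodule, as a submodule of the tensor square. Both submodules it is
  applied to are spanned by a part of the basis, so that the map from the abstract tensor
  square is injective.
\<close>

definition tensor_square :: "('m \<Rightarrow>\<^sub>0 'k::comm_ring_1) set \<Rightarrow> ('m \<times> 'm \<Rightarrow>\<^sub>0 'k) set" where
  "tensor_square S = module.span kscale {x \<otimes>\<^sub>t y | x y. x \<in> S \<and> y \<in> S}"


section \<open>The algebras V, W, their tensor squares, and the harmonic coproduct\<close>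

datatype letter = X0 | X1

type_synonym 'k V = "letter word \<Rightarrow>\<^sub>0 'k"
type_synonym 'k V2 = "letter word \<times> letter word \<Rightarrow>\<^sub>0 'k"

definition e0 :: "'k::comm_ring_1 V" where "e0 = gen X0"
definition e1 :: "'k::comm_ring_1 V" where "e1 = gen X1"
definition e_inf :: "'k::comm_ring_1 V" where "e_inf = - e0 - e1"

definition e1T :: "'k::comm_ring_1 V2" where "e1T = e1 \<otimes>\<^sub>t 1"
definition f1T :: "'k::comm_ring_1 V2" where "f1T = 1 \<otimes>\<^sub>t e1"

definition deg_word :: "'x word \<Rightarrow> int" where "deg_word w = int (length (letters w))"

definition V_part :: "int \<Rightarrow> 'k::comm_ring_1 V set" where
  "V_part = graded_part deg_word"

definition V2_part :: "int \<Rightarrow> 'k::comm_ring_1 V2 set" where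
  "V2_part = graded_part (\<lambda>(u, v). deg_word u + deg_word v)"

definition W :: "'k::comm_ring_1 V set" where
  "W = {kscale c 1 + v * e1 | c v. True}"

definition W_plus :: "'k::comm_ring_1 V set" where
  "W_plus = {v * e1 | v. True}"

definition W2 :: "'k::comm_ring_1 V2 set" where
  "W2 = tensor_square W"

definition y_W :: "nat \<Rightarrow> 'k::comm_ring_1 V" where
  "y_W n = - (e0 ^ (n - 1) * e1)"

text \<open>
  \<open>W\<close> is freely generated by the \<open>y_W n\<close>, \<open>n \<ge> 1\<close>: \<open>W_pres\<close> is injective with image \<open>W\<close>.
  The letter \<open>m\<close> of \<open>nat word\<close> stands for \<open>y_W (m + 1)\<close>.
\<close>

definition W_pres :: "(nat word \<Rightarrow>\<^sub>0 'k::comm_ring_1) \<Rightarrow> 'k V" where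
  "W_pres = free_lift kscale (\<lambda>m. y_W (Suc m))"

definition Delta_y :: "nat \<Rightarrow> 'k::comm_ring_1 V2" where
  "Delta_y n = y_W n \<otimes>\<^sub>t 1 + 1 \<otimes>\<^sub>t y_W n + (\<Sum>k = 1..n - 1. y_W k \<otimes>\<^sub>t y_W (n - k))"

text \<open>Only meaningful on \<open>W\<close>.\<close>

definition Delta_W :: "'k::comm_ring_1 V \<Rightarrow> 'k V2" where
  "Delta_W a = free_lift kscale (\<lambda>m. Delta_y (Suc m)) (inv W_pres a)"

definition mult_e1 :: "'k::comm_ring_1 V \<Rightarrow> 'k V \<Rightarrow> 'k V" where
  "mult_e1 a b = a * e1 * b"

definition mor :: "'k::comm_ring_1 V \<Rightarrow> 'k V" where
  "mor a = a * e1"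


section \<open>The localization at e1\<close>

text \<open>
  The algebra with generators \<open>e0\<close>, \<open>e1\<close>, \<open>e1\<^sup>-\<^sup>1\<close> is the monoid algebra of the monoid
  with the same presentation, since its relations are identities between words.
\<close>

datatype loc_letter = L0 | L1 | L1inv

inductive loc_eq :: "loc_letter word \<Rightarrow> loc_letter word \<Rightarrow> bool" where
  loc_refl: "loc_eq u u"
| loc_sym: "loc_eq u v \<Longrightarrow> loc_eq v u"
| loc_trans: "loc_eq u v \<Longrightarrow> loc_eq v w \<Longrightarrow> loc_eq u w"
| loc_plus: "loc_eq u u' \<Longrightarrow> loc_eq v v' \<Longrightarrow> loc_eq (u + v) (u' + v')"
| loc_right_inv: "loc_eq (Word [L1, L1inv]) 0"
| loc_left_inv: "loc_eq (Word [L1inv, L1]) 0"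

quotient_type loc_word = "loc_letter word" / loc_eq
  by (rule equivpI)
    (auto intro: reflpI sympI transpI loc_refl loc_sym elim: loc_trans)

instantiation loc_word :: monoid_add
begin

lift_definition zero_loc_word :: loc_word is 0 .
lift_definition plus_loc_word :: "loc_word \<Rightarrow> loc_word \<Rightarrow> loc_word" is "(+)"
  by (rule loc_plus)

instance
  by standard (transfer, simp add: add.assoc loc_refl)+

end

fun deg_loc_letter :: "loc_letter \<Rightarrow> int" where
  "deg_loc_letter L0 = 1"
| "deg_loc_letter L1 = 1"
| "deg_loc_letter L1inv = - 1"

lift_definition deg_loc :: "loc_word \<Rightarrow> int" is
  "\<lambda>w. sum_list (map deg_loc_letter (letters w))"
proof -
  fix u v assume "loc_eq u v"
  then show "sum_list (map deg_loc_letter (letters u)) = sum_list (map deg_loc_letter (letters v))"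
    by induction (auto simp: plus_word_def zero_word_def)
qed

type_synonym 'k Vloc = "loc_word \<Rightarrow>\<^sub>0 'k"
type_synonym 'k Vloc2 = "loc_word \<times> loc_word \<Rightarrow>\<^sub>0 'k"

definition loc_gen :: "loc_letter \<Rightarrow> 'k::comm_ring_1 Vloc" where
  "loc_gen x = Poly_Mapping.single (abs_loc_word (Word [x])) 1"

theorem Vloc_universal:
  fixes s :: "'k::comm_ring_1 \<Rightarrow> 'b \<Rightarrow> 'b::ring_1" and f :: "loc_letter \<Rightarrow> 'b"
  assumes "k_algebra s" "f L1 * f L1inv = 1" "f L1inv * f L1 = 1"
  shows "\<exists>!g. (\<forall>x z. g (x + z) = g x + g z) \<and> (\<forall>c x. g (kscale c x) = s c (g x)) \<and>
    (\<forall>x z. g (x * z) = g x * g z) \<and> g 1 = 1 \<and> (\<forall>a. g (loc_gen a) = f a)"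
proof -
  interpret k_algebra s by fact
  interpret module s by (rule mod)
  define F where "F w = prod_list (map f (letters w))" for w
  have F: "F u = F v" if "loc_eq u v" for u v
    using that assms(2,3) by induction (simp_all add: F_def plus_word_def zero_word_def)
  define h where "h m = F (rep_loc_word m)" for m
  have h_abs: "h (abs_loc_word w) = F w" for w
    unfolding h_def by (rule F, rule Quotient3_rep_abs[OF Quotient3_loc_word]) (rule loc_refl)
  have h_plus: "h (u + v) = h u * h v" for u v
  proof -
    have "h (u + v) = h (abs_loc_word (rep_loc_word u + rep_loc_word v))"
      by (metis plus_loc_word.abs_eq Quotient3_abs_rep[OF Quotient3_loc_word])
    then show ?thesis
      by (simp add: h_abs) (simp add: h_def F_def plus_word_def)
  qed
  have h_zero: "h 0 = 1"
    by (simp add: zero_loc_word_def h_abs) (simp add: F_def zero_word_def)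
  let ?L = "linear_lift s h"
  show ?thesis
  proof (rule ex1I[of _ ?L], intro conjI allI)
    show "?L 1 = 1"
      using linear_lift_single[of h 0 1] h_zero by simp
    show "?L (loc_gen a) = f a" for a
      by (simp add: loc_gen_def linear_lift_single h_abs F_def)
    fix g assume *: "(\<forall>x z. g (x + z) = g x + g z) \<and> (\<forall>c x. g (kscale c x) = s c (g x)) \<and>
      (\<forall>x z. g (x * z) = g x * g z) \<and> g 1 = 1 \<and> (\<forall>a. g (loc_gen a) = f a)"
    have w: "g (Poly_Mapping.single (abs_loc_word (Word l)) 1) = prod_list (map f l)" for l
    proof (induction l)
      case Nil
      then show ?case using * by (simp flip: zero_word_def zero_loc_word_def)
    next
      case (Cons a l)
      have "Poly_Mapping.single (abs_loc_word (Word (a # l))) 1 =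
          loc_gen a * Poly_Mapping.single (abs_loc_word (Word l)) (1::'k)"
        by (simp add: loc_gen_def mult_single plus_loc_word.abs_eq plus_word_def)
      with Cons * show ?case by simp
    qed
    have "g (Poly_Mapping.single m 1) = h m" for m
      using w[of "letters (rep_loc_word m)"]
      by (simp add: Quotient3_abs_rep[OF Quotient3_loc_word] h_def F_def)
    with * show "g = ?L" by (intro linear_lift_unique) auto
  qed (auto simp: linear_lift_add linear_lift_kscale linear_lift_mult h_plus)
qed

definition Vloc_ge0 :: "'k::comm_ring_1 Vloc set" where
  "Vloc_ge0 = {x. \<forall>m\<in>Poly_Mapping.keys x. deg_loc m \<ge> 0}"

definition Vloc_ge0_2 :: "'k::comm_ring_1 Vloc2 set" where
  "Vloc_ge0_2 = tensor_square Vloc_ge0"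

definition Vloc_ge0_2_part :: "int \<Rightarrow> 'k::comm_ring_1 Vloc2 set" where
  "Vloc_ge0_2_part n = Vloc_ge0_2 \<inter> graded_part (\<lambda>(u, v). deg_loc u + deg_loc v) n"

definition incl :: "'k::comm_ring_1 V \<Rightarrow> 'k Vloc" where
  "incl = free_lift kscale (\<lambda>x. case x of X0 \<Rightarrow> loc_gen L0 | X1 \<Rightarrow> loc_gen L1)"

definition incl2 :: "'k::comm_ring_1 V2 \<Rightarrow> 'k Vloc2" where
  "incl2 = tensor_map incl incl"

definition inv_e1f1 :: "'k::comm_ring_1 Vloc2" where
  "inv_e1f1 = loc_gen L1inv \<otimes>\<^sub>t loc_gen L1inv"


section \<open>The Lie algebra p5\<close>

datatype ('k, 'g) lie_term =
    LGen 'g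
  | LZero
  | LAdd "('k, 'g) lie_term" "('k, 'g) lie_term"
  | LScale 'k "('k, 'g) lie_term"
  | LBr "('k, 'g) lie_term" "('k, 'g) lie_term"

text \<open>
  The least congruence that contains \<open>R\<close> and makes the quotient a Lie algebra over \<open>'k\<close>,
  i.e. the quotient is the Lie algebra with generators \<open>'g\<close> and relations \<open>R\<close>.
\<close>

inductive lie_eq ::
  "(('k::comm_ring_1, 'g) lie_term \<Rightarrow> ('k, 'g) lie_term \<Rightarrow> bool) \<Rightarrow>
   ('k, 'g) lie_term \<Rightarrow> ('k, 'g) lie_term \<Rightarrow> bool"
  for R where
  lie_rel: "R x y \<Longrightarrow> lie_eq R x y"
| lie_refl: "lie_eq R x x"
| lie_sym: "lie_eq R x y \<Longrightarrow> lie_eq R y x"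
| lie_trans: "lie_eq R x y \<Longrightarrow> lie_eq R y z \<Longrightarrow> lie_eq R x z"
| lie_add_cong: "lie_eq R x x' \<Longrightarrow> lie_eq R y y' \<Longrightarrow> lie_eq R (LAdd x y) (LAdd x' y')"
| lie_scale_cong: "lie_eq R x x' \<Longrightarrow> lie_eq R (LScale c x) (LScale c x')"
| lie_br_cong: "lie_eq R x x' \<Longrightarrow> lie_eq R y y' \<Longrightarrow> lie_eq R (LBr x y) (LBr x' y')"
| lie_add_assoc: "lie_eq R (LAdd (LAdd x y) z) (LAdd x (LAdd y z))"
| lie_add_comm: "lie_eq R (LAdd x y) (LAdd y x)"
| lie_add_zero: "lie_eq R (LAdd LZero x) x"
| lie_scale_zero: "lie_eq R (LScale 0 x) LZero"
| lie_scale_one: "lie_eq R (LScale 1 x) x"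
| lie_scale_scale: "lie_eq R (LScale c (LScale d x)) (LScale (c * d) x)"
| lie_scale_add_left: "lie_eq R (LScale (c + d) x) (LAdd (LScale c x) (LScale d x))"
| lie_scale_add_right: "lie_eq R (LScale c (LAdd x y)) (LAdd (LScale c x) (LScale c y))"
| lie_br_add_left: "lie_eq R (LBr (LAdd x y) z) (LAdd (LBr x z) (LBr y z))"
| lie_br_add_right: "lie_eq R (LBr x (LAdd y z)) (LAdd (LBr x y) (LBr x z))"
| lie_br_scale_left: "lie_eq R (LBr (LScale c x) y) (LScale c (LBr x y))"
| lie_br_scale_right: "lie_eq R (LBr x (LScale c y)) (LScale c (LBr x y))"
| lie_br_alt: "lie_eq R (LBr x x) LZero"
| lie_jacobi: "lie_eq R (LAdd (LBr x (LBr y z)) (LAdd (LBr y (LBr z x)) (LBr z (LBr x y)))) LZero"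

typedef p5_gen = "{(i, j). i \<in> {1..5} \<and> j \<in> {1..5} \<and> i \<noteq> j} :: (nat \<times> nat) set"
  by (rule exI[of _ "(1, 2)"]) simp

abbreviation LE :: "nat \<Rightarrow> nat \<Rightarrow> ('k, p5_gen) lie_term" where
  "LE i j \<equiv> LGen (Abs_p5_gen (i, j))"

inductive p5_rel :: "('k::comm_ring_1, p5_gen) lie_term \<Rightarrow> ('k, p5_gen) lie_term \<Rightarrow> bool" where
  p5_symm: "i \<in> {1..5} \<Longrightarrow> j \<in> {1..5} \<Longrightarrow> i \<noteq> j \<Longrightarrow> p5_rel (LE i j) (LE j i)"
| p5_sum: "i \<in> {1..5} \<Longrightarrow>
    p5_rel (foldr LAdd (map (LE i) (filter (\<lambda>j. j \<noteq> i) [1, 2, 3, 4, 5])) LZero) LZero"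
| p5_comm: "i \<in> {1..5} \<Longrightarrow> j \<in> {1..5} \<Longrightarrow> k \<in> {1..5} \<Longrightarrow> l \<in> {1..5} \<Longrightarrow> distinct [i, j, k, l] \<Longrightarrow>
    p5_rel (LBr (LE i j) (LE k l)) LZero"

quotient_type (overloaded) 'k p5 = "('k::comm_ring_1, p5_gen) lie_term" / "lie_eq p5_rel"
  by (rule equivpI)
    (auto intro: reflpI sympI transpI lie_refl lie_sym elim: lie_trans)

lift_definition p5_zero :: "'k::comm_ring_1 p5" is LZero .
lift_definition p5_add :: "'k::comm_ring_1 p5 \<Rightarrow> 'k p5 \<Rightarrow> 'k p5" is LAdd
  by (rule lie_add_cong)
lift_definition p5_scale :: "'k::comm_ring_1 \<Rightarrow> 'k p5 \<Rightarrow> 'k p5" is LScale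
  by (rule lie_scale_cong)
lift_definition p5_br :: "'k::comm_ring_1 p5 \<Rightarrow> 'k p5 \<Rightarrow> 'k p5" is LBr
  by (rule lie_br_cong)
lift_definition p5_e :: "nat \<Rightarrow> nat \<Rightarrow> 'k::comm_ring_1 p5" is LE .


section \<open>The enveloping algebra of p5\<close>

text \<open>
  The enveloping algebra is the quotient of the free algebra on the underlying set of \<open>p5\<close> by the
  two-sided ideal generated by the relations that make \<open>p5 \<rightarrow> U p5\<close> linear and turn
  brackets into commutators.
\<close>

inductive_set U_relators :: "('k p5 word \<Rightarrow>\<^sub>0 'k::comm_ring_1) set" where
  "gen (p5_add x y) - gen x - gen y \<in> U_relators"
| "gen (p5_scale c x) - kscale c (gen x) \<in> U_relators"
| "gen (p5_br x y) - (gen x * gen y - gen y * gen x) \<in> U_relators"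

inductive_set U_ideal :: "('k p5 word \<Rightarrow>\<^sub>0 'k::comm_ring_1) set" where
  U_ideal_zero: "0 \<in> U_ideal"
| U_ideal_add: "x \<in> U_ideal \<Longrightarrow> y \<in> U_ideal \<Longrightarrow> x + y \<in> U_ideal"
| U_ideal_gen: "r \<in> U_relators \<Longrightarrow> a * r * b \<in> U_ideal"

lemma U_ideal_mult_left: "x \<in> U_ideal \<Longrightarrow> a * x \<in> U_ideal"
proof (induction rule: U_ideal.induct)
  case (U_ideal_gen r b c)
  then show ?case
    using U_ideal.U_ideal_gen[of r "a * b" c] by (simp add: mult.assoc)
qed (auto simp: distrib_left intro: U_ideal.intros)

lemma U_ideal_mult_right: "x \<in> U_ideal \<Longrightarrow> x * a \<in> U_ideal"
proof (induction rule: U_ideal.induct)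
  case (U_ideal_gen r b c)
  then show ?case
    using U_ideal.U_ideal_gen[of r b "c * a"] by (simp add: mult.assoc)
qed (auto simp: distrib_right intro: U_ideal.intros)

lemma U_ideal_uminus: "x \<in> U_ideal \<Longrightarrow> - x \<in> U_ideal"
  using U_ideal_mult_left[of x "- 1"] by simp

lemma U_ideal_diff: "x \<in> U_ideal \<Longrightarrow> y \<in> U_ideal \<Longrightarrow> x - y \<in> U_ideal"
  using U_ideal_add[of x "- y"] U_ideal_uminus[of y] by simp

quotient_type (overloaded) 'k Up5 =
  "'k::comm_ring_1 p5 word \<Rightarrow>\<^sub>0 'k" / "\<lambda>x y. x - y \<in> U_ideal"
proof (rule equivpI)
  show "reflp (\<lambda>x y :: 'k p5 word \<Rightarrow>\<^sub>0 'k. x - y \<in> U_ideal)"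
    by (auto intro!: reflpI U_ideal_zero)
  show "symp (\<lambda>x y :: 'k p5 word \<Rightarrow>\<^sub>0 'k. x - y \<in> U_ideal)"
    using U_ideal_uminus by (fastforce intro!: sympI)
  show "transp (\<lambda>x y :: 'k p5 word \<Rightarrow>\<^sub>0 'k. x - y \<in> U_ideal)"
    using U_ideal_add by (fastforce intro!: transpI)
qed


lemma lookup_mult_word_zero:
  fixes a b :: "'x word \<Rightarrow>\<^sub>0 'k::comm_ring_1"
  shows "Poly_Mapping.lookup (a * b) 0 = Poly_Mapping.lookup a 0 * Poly_Mapping.lookup b 0"
proof -
  have *: "0 = u + v \<longleftrightarrow> u = 0 \<and> v = 0" for u v :: "'x word"
    by (cases u; cases v) (auto simp: zero_word_def plus_word_def)
  have "(\<Sum>v. Poly_Mapping.lookup b v when 0 = u + v) = (Poly_Mapping.lookup b 0 when u = 0)" for u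
    by (cases "u = 0") (simp_all add: *)
  then show ?thesis
    by (simp add: lookup_mult mult_when)
qed

lemma U_ideal_augmentation:
  fixes x :: "'k::comm_ring_1 p5 word \<Rightarrow>\<^sub>0 'k"
  shows "x \<in> U_ideal \<Longrightarrow> Poly_Mapping.lookup x 0 = 0"
proof (induction rule: U_ideal.induct)
  case (U_ideal_gen r a b)
  have "Poly_Mapping.lookup (gen x :: 'k p5 word \<Rightarrow>\<^sub>0 'k) 0 = 0" for x
    by (simp add: gen_def lookup_single zero_word_def)
  with U_ideal_gen have "Poly_Mapping.lookup r 0 = 0"
    by (auto elim!: U_relators.cases simp: lookup_minus lookup_mult_word_zero kscale_conv_mult)
  then show ?case by (simp add: lookup_mult_word_zero)
qed (simp_all add: lookup_add)

instantiation Up5 :: (comm_ring_1) ring_1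
begin

lift_definition zero_Up5 :: "'a Up5" is 0 .
lift_definition one_Up5 :: "'a Up5" is 1 .
lift_definition plus_Up5 :: "'a Up5 \<Rightarrow> 'a Up5 \<Rightarrow> 'a Up5" is "(+)"
  using U_ideal_add by (fastforce simp: algebra_simps)
lift_definition uminus_Up5 :: "'a Up5 \<Rightarrow> 'a Up5" is uminus
  using U_ideal_uminus by fastforce
lift_definition minus_Up5 :: "'a Up5 \<Rightarrow> 'a Up5 \<Rightarrow> 'a Up5" is "(-)"
  using U_ideal_diff by (fastforce simp: algebra_simps)
lift_definition times_Up5 :: "'a Up5 \<Rightarrow> 'a Up5 \<Rightarrow> 'a Up5" is "(*)"
proof -
  fix x x' z z' :: "'a p5 word \<Rightarrow>\<^sub>0 'a"
  assume "x - x' \<in> U_ideal" "z - z' \<in> U_ideal"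
  then have "(x - x') * z + x' * (z - z') \<in> U_ideal"
    by (intro U_ideal_add U_ideal_mult_left U_ideal_mult_right)
  then show "x * z - x' * z' \<in> U_ideal"
    by (simp add: algebra_simps)
qed

instance
proof
  show "(0 :: 'a Up5) \<noteq> 1"
    by transfer (use U_ideal_augmentation in fastforce)
qed (transfer; simp add: algebra_simps U_ideal_zero)+

end

lift_definition Up5_scale :: "'k::comm_ring_1 \<Rightarrow> 'k Up5 \<Rightarrow> 'k Up5" is kscale
  using U_ideal_mult_left by (fastforce simp: kscale_conv_mult right_diff_distrib[symmetric])

definition Up5_of :: "'k::comm_ring_1 p5 \<Rightarrow> 'k Up5" where
  "Up5_of x = abs_Up5 (gen x)"

definition eU :: "nat \<Rightarrow> nat \<Rightarrow> 'k::comm_ring_1 Up5" where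
  "eU i j = Up5_of (p5_e i j)"


section \<open>Morphisms out of the enveloping algebra\<close>

fun lie_eval :: "('k \<Rightarrow> 'b \<Rightarrow> 'b) \<Rightarrow> ('g \<Rightarrow> 'b) \<Rightarrow> ('k, 'g) lie_term \<Rightarrow> 'b::ring_1" where
  "lie_eval s f (LGen g) = f g"
| "lie_eval s f LZero = 0"
| "lie_eval s f (LAdd x y) = lie_eval s f x + lie_eval s f y"
| "lie_eval s f (LScale c x) = s c (lie_eval s f x)"
| "lie_eval s f (LBr x y) = lie_eval s f x * lie_eval s f y - lie_eval s f y * lie_eval s f x"

text \<open>
  \<open>p5_lift f\<close> is the Lie algebra morphism from \<open>p5\<close> to a monoid algebra (with the commutator as
  bracket) that maps the generator \<open>e\<^sub>i\<^sub>j\<close> to \<open>f (i, j)\<close>, and \<open>U_lift \<phi>\<close> is the algebra morphism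
  induced by the Lie algebra morphism \<open>\<phi>\<close>. Both are computed on representatives;
  the results are independent of the choice if \<open>f\<close> respects the relations of \<open>p5\<close>
  and \<open>\<phi>\<close> is a Lie algebra morphism (\<open>p5_lift_abs\<close>, \<open>U_lift_abs\<close> below).
\<close>

definition p5_lift ::
  "(nat \<times> nat \<Rightarrow> ('m::monoid_add \<Rightarrow>\<^sub>0 'k::comm_ring_1)) \<Rightarrow> 'k p5 \<Rightarrow> ('m \<Rightarrow>\<^sub>0 'k)" where
  "p5_lift f x = lie_eval kscale (\<lambda>g. f (Rep_p5_gen g)) (rep_p5 x)"

definition U_lift ::
  "('k p5 \<Rightarrow> ('m::monoid_add \<Rightarrow>\<^sub>0 'k)) \<Rightarrow> 'k::comm_ring_1 Up5 \<Rightarrow> ('m \<Rightarrow>\<^sub>0 'k)" where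
  "U_lift \<phi> u = free_lift kscale \<phi> (rep_Up5 u)"

context k_algebra
begin

lemma lie_eval_cong:
  assumes R: "\<And>x z. R x z \<Longrightarrow> lie_eval s f x = lie_eval s f z"
    and "lie_eq R x z"
  shows "lie_eval s f x = lie_eval s f z"
  using assms(2)
proof induction
  case (lie_scale_add_left c d x)
  then show ?case by (simp add: module.scale_left_distrib[OF mod])
qed (simp_all add: R algebra_simps left right module.scale_right_distrib[OF mod]
  module.scale_right_diff_distrib[OF mod]
  module.scale_zero_left[OF mod] module.scale_one[OF mod] module.scale_scale[OF mod])

end

lemma p5_lift_abs:
  assumes "\<And>x z. p5_rel x z \<Longrightarrow>
    lie_eval kscale (\<lambda>g. f (Rep_p5_gen g)) x = lie_eval kscale (\<lambda>g. f (Rep_p5_gen g)) z"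
  shows "p5_lift f (abs_p5 t) = lie_eval kscale (\<lambda>g. f (Rep_p5_gen g)) t"
  unfolding p5_lift_def
  by (rule kscale_algebra.lie_eval_cong[OF assms])
    (auto intro: Quotient3_rep_abs[OF Quotient3_p5] lie_refl)

lemma U_lift_abs:
  assumes "\<And>x z. \<phi> (p5_add x z) = \<phi> x + \<phi> z" "\<And>c x. \<phi> (p5_scale c x) = kscale c (\<phi> x)"
    "\<And>x z. \<phi> (p5_br x z) = \<phi> x * \<phi> z - \<phi> z * \<phi> x"
  shows "U_lift \<phi> (abs_Up5 x) = free_lift kscale \<phi> x"
proof -
  have "free_lift kscale \<phi> r = 0" if "r \<in> U_relators" for r
    using that by cases (simp_all add: kscale_algebra.free_lift_diff kscale_algebra.free_lift_mult
        kscale_algebra.free_lift_gen kscale_algebra.free_lift_kscale assms)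
  note rel = this
  have *: "free_lift kscale \<phi> r = 0" if "r \<in> U_ideal" for r
    using that by (induction r)
      (simp_all add: rel kscale_algebra.free_lift_zero kscale_algebra.free_lift_add kscale_algebra.free_lift_mult)
  have "rep_Up5 (abs_Up5 x) - x \<in> U_ideal"
    using Quotient3_rep_abs[OF Quotient3_Up5, of x] by (simp add: U_ideal_zero)
  from *[OF this] show ?thesis
    by (simp add: U_lift_def kscale_algebra.free_lift_diff)
qed

lemma U_lift_alg:
  assumes "\<And>x z. \<phi> (p5_add x z) = \<phi> x + \<phi> z" "\<And>c x. \<phi> (p5_scale c x) = kscale c (\<phi> x)"
    "\<And>x z. \<phi> (p5_br x z) = \<phi> x * \<phi> z - \<phi> z * \<phi> x"
  shows "U_lift \<phi> (u + v) = U_lift \<phi> u + U_lift \<phi> v"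
    and "U_lift \<phi> (u * v) = U_lift \<phi> u * U_lift \<phi> v"
    and "U_lift \<phi> (Up5_scale c u) = kscale c (U_lift \<phi> u)"
    and "U_lift \<phi> 1 = 1"
    and "U_lift \<phi> (Up5_of x) = \<phi> x"
proof -
  obtain a b where ab: "u = abs_Up5 a" "v = abs_Up5 b"
    by (metis Quotient3_abs_rep[OF Quotient3_Up5])
  note [simp] = U_lift_abs[of \<phi>, OF assms, simplified]
  note free = kscale_algebra.free_lift_add kscale_algebra.free_lift_mult
    kscale_algebra.free_lift_kscale kscale_algebra.free_lift_one kscale_algebra.free_lift_gen
  show "U_lift \<phi> (u + v) = U_lift \<phi> u + U_lift \<phi> v"
    by (simp add: ab free plus_Up5.abs_eq)
  show "U_lift \<phi> (u * v) = U_lift \<phi> u * U_lift \<phi> v"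
    by (simp add: ab free times_Up5.abs_eq)
  show "U_lift \<phi> (Up5_scale c u) = kscale c (U_lift \<phi> u)"
    by (simp add: ab free Up5_scale.abs_eq)
  show "U_lift \<phi> 1 = 1"
    by (simp add: one_Up5_def free)
  show "U_lift \<phi> (Up5_of x) = \<phi> x"
    by (simp add: Up5_of_def free)
qed

definition respects_p5 :: "(nat \<times> nat \<Rightarrow> ('m::monoid_add \<Rightarrow>\<^sub>0 'k::comm_ring_1)) \<Rightarrow> bool" where
  "respects_p5 f \<longleftrightarrow>
    (\<forall>i\<in>{1..5}. \<forall>j\<in>{1..5}. i \<noteq> j \<longrightarrow> f (i, j) = f (j, i)) \<and>
    (\<forall>i\<in>{1..5}. (\<Sum>j\<in>{1..5}-{i}. f (i, j)) = 0) \<and>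
    (\<forall>i\<in>{1..5}. \<forall>j\<in>{1..5}. \<forall>k\<in>{1..5}. \<forall>l\<in>{1..5}. distinct [i, j, k, l] \<longrightarrow>
       f (i, j) * f (k, l) = f (k, l) * f (i, j))"

lemma Rep_Abs_p5_gen:
  "i \<in> {1..5} \<Longrightarrow> j \<in> {1..5} \<Longrightarrow> i \<noteq> j \<Longrightarrow> Rep_p5_gen (Abs_p5_gen (i, j)) = (i, j)"
  by (rule Abs_p5_gen_inverse) simp

lemma one_to_five: "{1..5} = {1, 2, 3, 4, 5 :: nat}"
  by auto

lemma respects_p5_lift:
  fixes f :: "nat \<times> nat \<Rightarrow> ('m::monoid_add \<Rightarrow>\<^sub>0 'k::comm_ring_1)"
  assumes "respects_p5 f"
  shows "p5_lift f (p5_add x z) = p5_lift f x + p5_lift f z"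
    and "p5_lift f (p5_scale c x) = kscale c (p5_lift f x)"
    and "p5_lift f (p5_br x z) = p5_lift f x * p5_lift f z - p5_lift f z * p5_lift f x"
    and "i \<in> {1..5} \<Longrightarrow> j \<in> {1..5} \<Longrightarrow> i \<noteq> j \<Longrightarrow> p5_lift f (p5_e i j) = f (i, j)"
proof -
  have rel: "lie_eval kscale (\<lambda>g. f (Rep_p5_gen g)) x = lie_eval kscale (\<lambda>g. f (Rep_p5_gen g)) z"
    if "p5_rel x z" for x z
    using that
  proof cases
    case (p5_symm i j)
    with assms show ?thesis by (simp add: respects_p5_def Rep_Abs_p5_gen)
  next
    case (p5_sum i)
    have "(\<Sum>j\<in>{1..5}-{i}. f (i, j)) = 0"
      using assms p5_sum(3) unfolding respects_p5_def by blast
    with p5_sum(3) show ?thesis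
      unfolding p5_sum(1,2) one_to_five
      by (auto simp: Rep_Abs_p5_gen insert_Diff_if algebra_simps)
  next
    case (p5_comm i j k l)
    with assms show ?thesis
      unfolding respects_p5_def by (simp add: Rep_Abs_p5_gen)
  qed
  note [simp] = p5_lift_abs[of f, OF rel, simplified]
  obtain a b where ab: "x = abs_p5 a" "z = abs_p5 b"
    by (metis Quotient3_abs_rep[OF Quotient3_p5])
  show "p5_lift f (p5_add x z) = p5_lift f x + p5_lift f z"
    by (simp add: ab p5_add.abs_eq)
  show "p5_lift f (p5_scale c x) = kscale c (p5_lift f x)"
    by (simp add: ab p5_scale.abs_eq)
  show "p5_lift f (p5_br x z) = p5_lift f x * p5_lift f z - p5_lift f z * p5_lift f x"
    by (simp add: ab p5_br.abs_eq)
  show "i \<in> {1..5} \<Longrightarrow> j \<in> {1..5} \<Longrightarrow> i \<noteq> j \<Longrightarrow> p5_lift f (p5_e i j) = f (i, j)"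
    by (simp add: p5_e.abs_eq Rep_Abs_p5_gen)
qed

definition pr1_gen :: "nat \<times> nat \<Rightarrow> 'k::comm_ring_1 V" where
  "pr1_gen = (\<lambda>(i, j).
     if 1 \<in> {i, j} then 0
     else if {i, j} \<in> {{2, 3}, {4, 5}} then e0
     else if {i, j} \<in> {{2, 5}, {3, 4}} then e1
     else e_inf)"

definition pr2_gen :: "nat \<times> nat \<Rightarrow> 'k::comm_ring_1 V" where
  "pr2_gen = (\<lambda>(i, j).
     if 2 \<in> {i, j} then 0
     else if {i, j} \<in> {{1, 4}, {3, 5}} then e0
     else if {i, j} \<in> {{1, 5}, {3, 4}} then e1
     else e_inf)"

definition pr1 :: "'k::comm_ring_1 Up5 \<Rightarrow> 'k V" where
  "pr1 = U_lift (p5_lift pr1_gen)"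

definition pr2 :: "'k::comm_ring_1 Up5 \<Rightarrow> 'k V" where
  "pr2 = U_lift (p5_lift pr2_gen)"

lemma respects_pr1_gen: "respects_p5 pr1_gen"
  unfolding respects_p5_def one_to_five
  by (simp add: pr1_gen_def e_inf_def insert_Diff_if doubleton_eq_iff insert_commute)

lemma respects_pr2_gen: "respects_p5 pr2_gen"
  unfolding respects_p5_def one_to_five
  by (simp add: pr2_gen_def e_inf_def insert_Diff_if doubleton_eq_iff)


lemma pr1_facts:
  fixes u v :: "'k::comm_ring_1 Up5"
  shows "pr1 (u + v) = pr1 u + pr1 v" "pr1 (u * v) = pr1 u * pr1 v"
  "pr1 (Up5_scale c u) = kscale c (pr1 u)" "pr1 (1 :: 'k Up5) = 1" "pr1 (Up5_of x :: 'k Up5) = p5_lift pr1_gen x"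
  "i \<in> {1..5} \<Longrightarrow> j \<in> {1..5} \<Longrightarrow> i \<noteq> j \<Longrightarrow> pr1 (eU i j :: 'k Up5) = pr1_gen (i, j)"
  by (simp_all add: pr1_def eU_def respects_p5_lift(4)[OF respects_pr1_gen]
      U_lift_alg[of "p5_lift pr1_gen", OF respects_p5_lift(1-3)[OF respects_pr1_gen]])

lemma pr2_facts:
  fixes u v :: "'k::comm_ring_1 Up5"
  shows "pr2 (u + v) = pr2 u + pr2 v" "pr2 (u * v) = pr2 u * pr2 v"
  "pr2 (Up5_scale c u) = kscale c (pr2 u)" "pr2 (1 :: 'k Up5) = 1" "pr2 (Up5_of x :: 'k Up5) = p5_lift pr2_gen x"
  "i \<in> {1..5} \<Longrightarrow> j \<in> {1..5} \<Longrightarrow> i \<noteq> j \<Longrightarrow> pr2 (eU i j :: 'k Up5) = pr2_gen (i, j)"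
  by (simp_all add: pr2_def eU_def respects_p5_lift(4)[OF respects_pr2_gen]
      U_lift_alg[of "p5_lift pr2_gen", OF respects_p5_lift(1-3)[OF respects_pr2_gen]])

definition pr12 :: "'k::comm_ring_1 Up5 \<Rightarrow> 'k V2" where
  "pr12 = U_lift (\<lambda>x. pr1 (Up5_of x) \<otimes>\<^sub>t 1 + 1 \<otimes>\<^sub>t pr2 (Up5_of x))"

lemma pr12_facts:
  fixes u v :: "'k::comm_ring_1 Up5" and x :: "'k p5"
  shows "pr12 (u + v) = pr12 u + pr12 v" "pr12 (u * v) = pr12 u * pr12 v"
  "pr12 (Up5_scale c u) = kscale c (pr12 u)" "pr12 (1 :: 'k Up5) = 1"
  "pr12 (Up5_of x) = pr1 (Up5_of x) \<otimes>\<^sub>t 1 + 1 \<otimes>\<^sub>t pr2 (Up5_of x)"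
proof -
  let ?\<phi> = "\<lambda>x :: 'k p5. pr1 (Up5_of x) \<otimes>\<^sub>t 1 + 1 \<otimes>\<^sub>t pr2 (Up5_of x)"
  have diff: "(x - x') \<otimes>\<^sub>t z = x \<otimes>\<^sub>t z - x' \<otimes>\<^sub>t z" "z \<otimes>\<^sub>t (x - x') = z \<otimes>\<^sub>t x - z \<otimes>\<^sub>t x'"
    for x x' z :: "'k V"
    by (rule poly_mapping_eqI; auto simp: lookup_tensor lookup_minus algebra_simps)+
  have 1: "?\<phi> (p5_add x z) = ?\<phi> x + ?\<phi> z" for x z
    by (simp add: pr1_facts(5) pr2_facts(5) respects_p5_lift(1)[OF respects_pr1_gen]
        respects_p5_lift(1)[OF respects_pr2_gen] tensor_add_left tensor_add_right)
  have 2: "?\<phi> (p5_scale c x) = kscale c (?\<phi> x)" for c x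
    by (simp add: pr1_facts(5) pr2_facts(5) respects_p5_lift(2)[OF respects_pr1_gen]
        respects_p5_lift(2)[OF respects_pr2_gen] tensor_kscale_left tensor_kscale_right
        module.scale_right_distrib[OF module_kscale])
  have 3: "?\<phi> (p5_br x z) = ?\<phi> x * ?\<phi> z - ?\<phi> z * ?\<phi> x" for x z
    by (simp add: pr1_facts(5) pr2_facts(5) respects_p5_lift(3)[OF respects_pr1_gen]
        respects_p5_lift(3)[OF respects_pr2_gen] diff distrib_left distrib_right tensor_mult)
  show "pr12 (u + v) = pr12 u + pr12 v" "pr12 (u * v) = pr12 u * pr12 v"
    "pr12 (Up5_scale c u) = kscale c (pr12 u)" "pr12 (1 :: 'k Up5) = 1" "pr12 (Up5_of x) = ?\<phi> x"
    by (simp_all only: pr12_def U_lift_alg[of ?\<phi>, OF 1 2 3])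
qed

definition ell :: "'k::comm_ring_1 V \<Rightarrow> 'k Up5" where
  "ell = free_lift Up5_scale (\<lambda>x. case x of X0 \<Rightarrow> eU 2 3 | X1 \<Rightarrow> eU 1 2)"


section \<open>The matrices\<close>

definition e_5 :: "'k::comm_ring_1 Up5 ^ 3" where
  "e_5 = vector [eU 1 5, eU 2 5, eU 3 5]"

text \<open>
  There is exactly one such matrix, since the entries of \<open>e_5\<close> form a basis, as a left module, of the
  kernel of the morphism \<open>U p5 \<rightarrow> V\<close> killing all \<open>e\<^sub>j\<^sub>5\<close>, which is a two-sided ideal.
\<close>

definition varpi :: "'k::comm_ring_1 Up5 \<Rightarrow> 'k Up5 ^ 3 ^ 3" where
  "varpi p = (THE A. \<forall>i. e_5 $ i * p = (\<Sum>j\<in>UNIV. A $ i $ j * e_5 $ j))"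

definition rho :: "'k::comm_ring_1 V \<Rightarrow> 'k V2 ^ 3 ^ 3" where
  "rho a = map_matrix pr12 (varpi (ell a))"

definition M3_scale :: "'k \<Rightarrow> 'k V2 ^ 3 ^ 3 \<Rightarrow> 'k::comm_ring_1 V2 ^ 3 ^ 3" where
  "M3_scale c = map_matrix (kscale c)"

definition M3_part :: "int \<Rightarrow> ('k::comm_ring_1 V2 ^ 3 ^ 3) set" where
  "M3_part n = {X. \<forall>i j. X $ i $ j \<in> V2_part n}"

definition row1 :: "'k::comm_ring_1 V2 ^ 3 ^ 1" where
  "row1 = vector [vector [e1T, - f1T, 0]]"

definition col1 :: "'k::comm_ring_1 V2 ^ 1 ^ 3" where
  "col1 = vector [vector [1], vector [- 1], vector [0]]"

definition sandwich :: "'k::comm_ring_1 V2 ^ 3 ^ 3 \<Rightarrow> 'k Vloc2" where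
  "sandwich X = inv_e1f1 * incl2 ((row1 ** X ** col1) $ 1 $ 1) * incl2 (e1T * f1T)"

end

theory Submission
  imports Defs
begin

text \<open>
  The rows of \<open>varpi\<close> are unique because \<open>e\<^sub>1\<^sub>5, e\<^sub>2\<^sub>5, e\<^sub>3\<^sub>5\<close> are left independent in
  \<open>U p5\<close>. Let \<open>\<sigma>\<close> be the endomorphism of \<open>U p5\<close> obtained by composing \<open>pr\<^sub>5\<close> with its section
  \<open>e0 \<mapsto> e\<^sub>2\<^sub>3\<close>, \<open>e1 \<mapsto> e\<^sub>1\<^sub>2\<close>, and write \<open>u - \<sigma> u = \<Sum> D\<^sub>j(u) e\<^sub>j\<^sub>5\<close>. The Fox derivatives satisfy
  \<open>D(u v) = u D(v) + D(u) \<cdot> varpi (\<sigma> v)\<close>, so they exist as the off-diagonal entry of a morphism to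
  triangular matrices, \<open>u \<mapsto> ((u, D u), (0, varpi (\<sigma> u)))\<close>, which is defined on generators. Only the
  defining relations of \<open>p5\<close> have to be checked, and no structure theory of \<open>p5\<close> is needed.

  For the identity, \<open>rho e1 = col1 \<cdot> row1\<close> makes \<open>a \<mapsto> row1 \<cdot> rho a \<cdot> col1\<close> send \<open>a e1 b\<close> to the
  product of the values at \<open>a\<close> and \<open>b\<close>, which reduces everything to \<open>a = e0\<^sup>n\<close>. There
  \<open>rho e0\<close> has the left eigenvector \<open>(0, 1, 1)\<close> with eigenvalue \<open>e0\<close>, so that
  \<open>rho (e0\<^sup>n) \<cdot> col1\<close> obeys a first-order recursion, whose solution is the convolution
  in the coproduct of \<open>y\<^sub>n\<^sub>+\<^sub>1\<close>.
\<close>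

section \<open>Universal property of the enveloping algebra\<close>

lemma k_algebra_Up5: "k_algebra (Up5_scale :: 'k::comm_ring_1 \<Rightarrow> 'k Up5 \<Rightarrow> 'k Up5)"
proof
  interpret ks: module "kscale :: 'k \<Rightarrow> ('k p5 word \<Rightarrow>\<^sub>0 'k) \<Rightarrow> _" by (rule module_kscale)
  fix c d :: 'k and u v :: "'k Up5"
  show "Up5_scale c (u + v) = Up5_scale c u + Up5_scale c v"
    by transfer (simp add: ks.scale_right_distrib U_ideal_zero)
  show "Up5_scale (c + d) u = Up5_scale c u + Up5_scale d u"
    by transfer (simp add: ks.scale_left_distrib U_ideal_zero)
  show "Up5_scale c (Up5_scale d u) = Up5_scale (c * d) u"
    by transfer (simp add: U_ideal_zero)
  show "Up5_scale 1 u = u"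
    by transfer (simp add: U_ideal_zero)
  show "Up5_scale c u * v = Up5_scale c (u * v)"
    by transfer (simp add: kscale_mult_left U_ideal_zero)
  show "u * Up5_scale c v = Up5_scale c (u * v)"
    by transfer (simp add: kscale_mult_right U_ideal_zero)
qed

interpretation Up5: k_algebra Up5_scale
  by (rule k_algebra_Up5)

interpretation Up5_module: module Up5_scale
  by (rule Up5.mod)

lemma Up5_of_hom:
  fixes x y :: "'a::comm_ring_1 p5"
  shows
  "Up5_of (p5_add x y) = Up5_of x + Up5_of y"
  "Up5_of (p5_scale c x) = Up5_scale c (Up5_of x)"
  "Up5_of (p5_br x y) = Up5_of x * Up5_of y - Up5_of y * Up5_of x"
proof -
  have "r \<in> U_ideal" if "r \<in> U_relators" for r :: "'a p5 word \<Rightarrow>\<^sub>0 'a"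
    using U_ideal_gen[OF that, of 1 1] by simp
  note rel = U_relators.intros[THEN this]
  show "Up5_of (p5_add x y) = Up5_of x + Up5_of y"
    using rel(1)[of x y] by (simp add: Up5_of_def plus_Up5.abs_eq Up5.abs_eq_iff diff_diff_eq)
  show "Up5_of (p5_scale c x) = Up5_scale c (Up5_of x)"
    using rel(2)[of c x] by (simp add: Up5_of_def Up5_scale.abs_eq Up5.abs_eq_iff)
  show "Up5_of (p5_br x y) = Up5_of x * Up5_of y - Up5_of y * Up5_of x"
    using rel(3)[of x y]
    by (simp add: Up5_of_def minus_Up5.abs_eq times_Up5.abs_eq Up5.abs_eq_iff)
qed

lemma Up5_of_abs_p5:
  "Up5_of (abs_p5 t) = lie_eval Up5_scale (\<lambda>g. case Rep_p5_gen g of (i, j) \<Rightarrow> eU i j) t"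
proof (induction t)
  case (LGen g)
  show ?case
    by (simp add: eU_def p5_e.abs_eq Rep_p5_gen_inverse split: prod.split)
next
  case LZero
  \<comment> \<open>No relator mentions the zero of \<open>p5\<close>; written as \<open>0\<close>
    times itself, it falls under the scaling relator.\<close>
  have "abs_p5 LZero = p5_scale 0 (abs_p5 LZero)"
    by (simp add: p5_scale.abs_eq p5.abs_eq_iff lie_sym[OF lie_scale_zero])
  then show ?case
    by (metis Up5_of_hom(2) Up5_module.scale_zero_left lie_eval.simps(2))
qed (simp_all add: Up5_of_hom flip: p5_add.abs_eq p5_scale.abs_eq p5_br.abs_eq)

text \<open>Letters are appended on the right, so that in \<open>W_pres (x * gen g) * e0 ^ m\<close>
  the new factor stands next to the power of \<open>e0\<close>.\<close>

lemma free_algebra_induct [case_names scalar gen add]: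
  fixes x :: "'x word \<Rightarrow>\<^sub>0 'k::comm_ring_1"
  assumes scalar: "\<And>c. P (kscale c 1)"
    and gen: "\<And>x g. P x \<Longrightarrow> P (x * gen g)"
    and add: "\<And>x z. P x \<Longrightarrow> P z \<Longrightarrow> P (x + z)"
  shows "P x"
proof (induction x rule: pm_induct)
  case 1
  show ?case using scalar[of 0] by (simp add: module.scale_zero_left[OF module_kscale])
next
  case (2 u c)
  have "P (Poly_Mapping.single (Word l) c)" for l
  proof (induction l rule: rev_induct)
    case Nil
    show ?case using scalar[of c]
      by (simp add: kscale_single zero_word_def flip: single_one)
  next
    case (snoc g l)
    have "Poly_Mapping.single (Word (l @ [g])) c = Poly_Mapping.single (Word l) c * gen g"
      by (simp add: gen_def mult_single plus_word_def)
    with gen[OF snoc] show ?case by simp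
  qed
  then show ?case by (cases u) simp
qed (rule add)

text \<open>Every element of \<open>p5\<close> becomes a Lie polynomial in the \<open>eU i j\<close>
  with commutators as brackets, so the \<open>eU i j\<close> generate \<open>U p5\<close> as an
  algebra.\<close>

lemma Up5_induct [case_names one eU add mult scale]:
  fixes u :: "'k::comm_ring_1 Up5"
  assumes one: "P 1"
    and eU: "\<And>i j. i \<in> {1..5} \<Longrightarrow> j \<in> {1..5} \<Longrightarrow> i \<noteq> j \<Longrightarrow> P (eU i j)"
    and add: "\<And>u v. P u \<Longrightarrow> P v \<Longrightarrow> P (u + v)"
    and mult: "\<And>u v. P u \<Longrightarrow> P v \<Longrightarrow> P (u * v)"
    and scale: "\<And>c u. P u \<Longrightarrow> P (Up5_scale c u)"
  shows "P u"
proof -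
  have diff: "P (u - v)" if "P u" "P v" for u v
    using add[OF that(1) scale[OF that(2), of "- 1"]] by simp
  have "P (lie_eval Up5_scale (\<lambda>g. case Rep_p5_gen g of (i, j) \<Rightarrow> eU i j) t)" for t
  proof (induction t)
    case (LGen g)
    obtain i j where "Rep_p5_gen g = (i, j)" by fastforce
    with Rep_p5_gen[of g] show ?case
      using eU[of i j] by simp
  next
    case LZero
    show ?case using scale[OF one, of 0] by simp
  qed (auto intro: add mult scale diff)
  then have of: "P (Up5_of x)" for x
    by (metis Up5_of_abs_p5 Quotient3_abs_rep[OF Quotient3_p5])
  have "P (abs_Up5 x)" for x
  proof (induction x rule: free_algebra_induct)
    case (scalar c)
    show ?case using scale[OF one, of c] by (simp add: one_Up5_def Up5_scale.abs_eq)
  next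
    case (gen x g)
    then show ?case using mult[OF _ of[of g], of "abs_Up5 x"] by (simp add: Up5_of_def times_Up5.abs_eq)
  next
    case (add x z)
    then show ?case using assms(3) by (simp flip: plus_Up5.abs_eq)
  qed
  then show ?thesis
    by (metis Quotient3_abs_rep[OF Quotient3_Up5])
qed

context k_algebra
begin

text \<open>The relations of \<open>p5\<close> present \<open>U p5\<close> as an associative
  algebra. \<open>U_lift\<close> only reaches monoid algebras, whereas the independence proof needs
  a map to triangular matrices. Evaluating Lie terms with commutators respects the relations of
  \<open>p5\<close>, and the extension to the free algebra then kills the relators.\<close>

theorem Up5_universal:
  fixes f :: "nat \<Rightarrow> nat \<Rightarrow> 'b"
  assumes symm: "\<And>i j. i \<in> {1..5} \<Longrightarrow> j \<in> {1..5} \<Longrightarrow> i \<noteq> j \<Longrightarrow> f i j = f j i"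
    and sum: "\<And>i. i \<in> {1..5} \<Longrightarrow> (\<Sum>j\<in>{1..5}-{i}. f i j) = 0"
    and comm: "\<And>i j k l. \<lbrakk>i \<in> {1..5}; j \<in> {1..5}; k \<in> {1..5}; l \<in> {1..5}; distinct [i, j, k, l]\<rbrakk>
      \<Longrightarrow> f i j * f k l = f k l * f i j"
  shows "\<exists>F :: 'k Up5 \<Rightarrow> 'b. (\<forall>u v. F (u + v) = F u + F v) \<and> (\<forall>u v. F (u * v) = F u * F v) \<and>
    (\<forall>c u. F (Up5_scale c u) = s c (F u)) \<and> F 1 = 1 \<and>
    (\<forall>i\<in>{1..5}. \<forall>j\<in>{1..5}. i \<noteq> j \<longrightarrow> F (eU i j) = f i j)"
proof -
  define ev where "ev = lie_eval s (\<lambda>g. case Rep_p5_gen g of (i, j) \<Rightarrow> f i j)"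
  have rel: "ev x = ev z" if "p5_rel x z" for x z
    using that
  proof cases
    case (p5_symm i j)
    then show ?thesis using symm by (simp add: ev_def Rep_Abs_p5_gen)
  next
    case (p5_sum i)
    with sum[OF p5_sum(3)] show ?thesis
      unfolding p5_sum(1,2) one_to_five
      by (auto simp: ev_def Rep_Abs_p5_gen insert_Diff_if algebra_simps)
  next
    case (p5_comm i j k l)
    with comm[OF p5_comm(3-7)] show ?thesis by (simp add: ev_def Rep_Abs_p5_gen)
  qed
  have ev_cong: "ev x = ev z" if "lie_eq p5_rel x z" for x z
    using lie_eval_cong[of p5_rel _ x z, OF rel[unfolded ev_def] that] by (simp add: ev_def)
  define \<phi> where "\<phi> x = ev (rep_p5 x)" for x
  have \<phi>_abs: "\<phi> (abs_p5 t) = ev t" for t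
    unfolding \<phi>_def by (rule ev_cong, rule Quotient3_rep_abs[OF Quotient3_p5]) (rule lie_refl)
  have \<phi>_hom: "\<phi> (p5_add x z) = \<phi> x + \<phi> z" "\<phi> (p5_scale c x) = s c (\<phi> x)"
    "\<phi> (p5_br x z) = \<phi> x * \<phi> z - \<phi> z * \<phi> x" for x z c
  proof -
    obtain a b where ab: "x = abs_p5 a" "z = abs_p5 b"
      by (metis Quotient3_abs_rep[OF Quotient3_p5])
    show "\<phi> (p5_add x z) = \<phi> x + \<phi> z" "\<phi> (p5_scale c x) = s c (\<phi> x)"
      "\<phi> (p5_br x z) = \<phi> x * \<phi> z - \<phi> z * \<phi> x"
      by (simp_all add: ab p5_add.abs_eq p5_scale.abs_eq p5_br.abs_eq \<phi>_abs) (simp_all add: ev_def)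
  qed
  have rel0: "free_lift s \<phi> r = 0" if "r \<in> U_relators" for r
    using that by cases (simp_all add: free_lift_diff free_lift_mult free_lift_gen free_lift_kscale \<phi>_hom)
  have ideal: "free_lift s \<phi> r = 0" if "r \<in> U_ideal" for r
    using that by (induction rule: U_ideal.induct) (simp_all add: rel0 free_lift_zero free_lift_add free_lift_mult)
  define F where "F u = free_lift s \<phi> (rep_Up5 u)" for u
  have F_abs: "F (abs_Up5 x) = free_lift s \<phi> x" for x
  proof -
    have "rep_Up5 (abs_Up5 x) - x \<in> U_ideal"
      using Quotient3_rep_abs[OF Quotient3_Up5, of x] by (simp add: U_ideal_zero)
    from ideal[OF this] show ?thesis
      by (simp add: F_def free_lift_diff)
  qed
  show ?thesis
  proof (intro exI[of _ F] conjI allI ballI impI)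
    fix u v :: "'k Up5" and c :: 'k
    obtain a b where ab: "u = abs_Up5 a" "v = abs_Up5 b"
      by (metis Quotient3_abs_rep[OF Quotient3_Up5])
    show "F (u + v) = F u + F v" "F (u * v) = F u * F v" "F (Up5_scale c u) = s c (F u)"
      by (simp_all add: ab plus_Up5.abs_eq times_Up5.abs_eq Up5_scale.abs_eq F_abs
          free_lift_add free_lift_mult free_lift_kscale)
    show "F 1 = 1"
      by (simp add: one_Up5_def F_abs free_lift_one)
  next
    fix i j :: nat assume "i \<in> {1..5}" "j \<in> {1..5}" "i \<noteq> j"
    then show "F (eU i j) = f i j"
      by (simp add: eU_def Up5_of_def F_abs free_lift_gen p5_e.abs_eq \<phi>_abs)
        (simp add: ev_def Rep_Abs_p5_gen)
  qed
qed

end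

section \<open>The relations of p5 inside the enveloping algebra\<close>

lemma eU_symm: "i \<in> {1..5} \<Longrightarrow> j \<in> {1..5} \<Longrightarrow> i \<noteq> j \<Longrightarrow> eU i j = eU j i"
  unfolding eU_def p5_e.abs_eq by (metis p5.abs_eq_iff lie_rel p5_symm)

lemma eU_sum:
  assumes "i \<in> {1..5}"
  shows "(\<Sum>j\<in>{1..5}-{i}. eU i j) = (0 :: 'k::comm_ring_1 Up5)"
proof -
  have "Up5_of (abs_p5 (foldr LAdd (map (LE i) (filter (\<lambda>j. j \<noteq> i) [1, 2, 3, 4, 5])) LZero)) =
      Up5_of (abs_p5 (LZero :: ('k, _) lie_term))"
    using p5_sum[OF assms] by (metis p5.abs_eq_iff lie_rel)
  with assms show ?thesis
    unfolding Up5_of_abs_p5 one_to_five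
    by (auto simp: Rep_Abs_p5_gen insert_Diff_if algebra_simps)
qed

lemma eU_comm:
  assumes "i \<in> {1..5}" "j \<in> {1..5}" "k \<in> {1..5}" "l \<in> {1..5}" "distinct [i, j, k, l]"
  shows "eU i j * eU k l = (eU k l * eU i j :: 'k::comm_ring_1 Up5)"
proof -
  have "Up5_of (abs_p5 (LBr (LE i j) (LE k l))) = Up5_of (abs_p5 (LZero :: ('k, _) lie_term))"
    using p5_comm[OF assms] by (metis p5.abs_eq_iff lie_rel)
  with assms show ?thesis
    unfolding Up5_of_abs_p5 by (simp add: Rep_Abs_p5_gen)
qed

section \<open>Independence of the basis of the kernel\<close>

text \<open>Block upper triangular 4 by 4 matrices. They get a type of their own because
  \<open>Up5_universal\<close> needs a ring under the matrix product, while the ring product on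
  vector types is entrywise.\<close>

datatype 'a tri = Tri (corner: 'a) (top_row: "'a ^ 3") (block: "'a ^ 3 ^ 3")

instantiation tri :: (ring_1) ring_1
begin

definition "0 = Tri 0 0 0"
definition "1 = Tri 1 0 (mat 1)"
definition "X + Y = Tri (corner X + corner Y) (top_row X + top_row Y) (block X + block Y)"
definition "X - Y = Tri (corner X - corner Y) (top_row X - top_row Y) (block X - block Y)"
definition "- X = Tri (- corner X) (- top_row X) (- block X)"
definition "X * Y = Tri (corner X * corner Y)
  (\<chi> l. corner X * top_row Y $ l + (\<Sum>k\<in>UNIV. top_row X $ k * block Y $ k $ l))
  (block X ** block Y)"

instance
proof
  fix X Y Z :: "'a tri"
  show "X + Y + Z = X + (Y + Z)" "X + Y = Y + X" "0 + X = X" "- X + X = 0" "X - Y = X + - Y"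
    by (simp_all add: zero_tri_def plus_tri_def minus_tri_def uminus_tri_def algebra_simps)
  show "0 \<noteq> (1 :: 'a tri)"
    by (simp add: zero_tri_def one_tri_def)
  show "X * Y * Z = X * (Y * Z)"
    by (simp add: times_tri_def matrix_mul_assoc mult.assoc vec_eq_iff matrix_matrix_mult_def
        sum_3 algebra_simps)
  show "1 * X = X" "X * 1 = X"
    by (simp_all add: times_tri_def one_tri_def tri.expand matrix_mul_lid matrix_mul_rid
        if_distrib[of "\<lambda>x. _ * x"] mat_def[THEN arg_cong, of "\<lambda>A. A $ _ $ _"] vec_lambda_eta cong: if_cong)
  show "(X + Y) * Z = X * Z + Y * Z" "X * (Y + Z) = X * Y + X * Z"
    by (simp_all add: times_tri_def plus_tri_def matrix_matrix_mult_def vec_eq_iff sum.distrib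
        algebra_simps)
qed

end

definition tri_scale :: "'k::comm_ring_1 \<Rightarrow> 'k Up5 tri \<Rightarrow> 'k Up5 tri" where
  "tri_scale c X = Tri (Up5_scale c (corner X)) (\<chi> j. Up5_scale c (top_row X $ j))
     (\<chi> i j. Up5_scale c (block X $ i $ j))"

lemma k_algebra_tri: "k_algebra (tri_scale :: 'k::comm_ring_1 \<Rightarrow> _)"
proof
  fix c d :: 'k and X Y :: "'k Up5 tri"
  show "tri_scale c (X + Y) = tri_scale c X + tri_scale c Y"
    "tri_scale (c + d) X = tri_scale c X + tri_scale d X"
    "tri_scale c (tri_scale d X) = tri_scale (c * d) X" "tri_scale 1 X = X"
    by (simp_all add: tri_scale_def plus_tri_def vec_eq_iff Up5_module.scale_right_distrib
        Up5_module.scale_left_distrib tri.expand)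
  show "tri_scale c X * Y = tri_scale c (X * Y)" "X * tri_scale c Y = tri_scale c (X * Y)"
    by (simp_all add: tri_scale_def times_tri_def vec_eq_iff matrix_matrix_mult_def Up5.left
        Up5.right Up5_module.scale_right_distrib Up5_module.scale_sum_right)
qed

interpretation tri: k_algebra tri_scale
  by (rule k_algebra_tri)

section \<open>The linear relations solved for five generators\<close>

context
  fixes h :: "rat \<Rightarrow> 'k::comm_ring_1"
  assumes h: "rat_algebra_map h"
begin

text \<open>Rational scalars enter here: 2 is invertible among the scalars, so \<open>U p5\<close>
  has no 2-torsion.\<close>

lemma Up5_double_eq_0:
  fixes u :: "'k Up5"
  assumes "u + u = 0"
  shows "u = 0"
proof -
  have "h (1/2) + h (1/2) = h (1/2 + 1/2)"
    using h unfolding rat_algebra_map_def by metis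
  also have "\<dots> = 1"
    using h by (simp add: rat_algebra_map_def)
  finally have "u = Up5_scale (h (1/2)) u + Up5_scale (h (1/2)) u"
    by (simp flip: Up5_module.scale_left_distrib)
  also have "\<dots> = Up5_scale (h (1/2)) (u + u)"
    by (simp add: Up5_module.scale_right_distrib)
  finally show ?thesis by (simp add: assms)
qed

lemma eU_eqs:
  defines "x1 \<equiv> eU 1 5 :: 'k Up5" and "x2 \<equiv> eU 2 5" and "x3 \<equiv> eU 3 5"
    and "a \<equiv> eU 2 3" and "b \<equiv> eU 1 2"
  shows "eU 1 3 = - x1 - x2 - x3 - a - b" "eU 1 4 = x2 + x3 + a" "eU 2 4 = - a - b - x2"
    "eU 3 4 = x1 + x2 + b" "eU 4 5 = - x1 - x2 - x3"
proof -
  have symm: "eU 2 1 = (eU 1 2 :: 'k Up5)" "eU 3 1 = (eU 1 3 :: 'k Up5)"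
    "eU 4 1 = (eU 1 4 :: 'k Up5)" "eU 5 1 = (eU 1 5 :: 'k Up5)"
    "eU 3 2 = (eU 2 3 :: 'k Up5)" "eU 4 2 = (eU 2 4 :: 'k Up5)" "eU 5 2 = (eU 2 5 :: 'k Up5)"
    "eU 4 3 = (eU 3 4 :: 'k Up5)" "eU 5 3 = (eU 3 5 :: 'k Up5)" "eU 5 4 = (eU 4 5 :: 'k Up5)"
    by (rule eU_symm; simp)+
  have S: "b + eU 1 3 + eU 1 4 + x1 = 0" "b + a + eU 2 4 + x2 = 0"
    "eU 1 3 + a + eU 3 4 + x3 = 0" "eU 1 4 + eU 2 4 + eU 3 4 + eU 4 5 = (0 :: 'k Up5)"
    "x1 + x2 + x3 + eU 4 5 = 0"
    using eU_sum[of 1, where 'k='k] eU_sum[of 2, where 'k='k] eU_sum[of 3, where 'k='k]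
      eU_sum[of 4, where 'k='k] eU_sum[of 5, where 'k='k]
    unfolding one_to_five assms
    by (simp_all add: insert_Diff_if symm add.assoc del: One_nat_def)
  show e45: "eU 4 5 = - x1 - x2 - x3" and e24: "eU 2 4 = - a - b - x2"
    using S(2,5) by (simp_all add: algebra_simps eq_neg_iff_add_eq_0)
  have e13: "eU 1 3 = - b - eU 1 4 - x1"
    using S(1) by (simp add: algebra_simps eq_neg_iff_add_eq_0)
  have e34: "eU 3 4 = - eU 1 3 - a - x3"
    using S(3) by (simp add: algebra_simps eq_neg_iff_add_eq_0)
  \<comment> \<open>Once the other four sums have eliminated the remaining unknowns, the sum at
    index 4 determines only the double of \<open>eU 1 4\<close>.\<close>
  have "(eU 1 4 - x2 - x3 - a) + (eU 1 4 - x2 - x3 - a) = 0"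
    using S(4) unfolding e34 e13 e24 e45 by (simp add: algebra_simps)
  from Up5_double_eq_0[OF this] show e14: "eU 1 4 = x2 + x3 + a"
    by (simp add: algebra_simps)
  show "eU 1 3 = - x1 - x2 - x3 - a - b" "eU 3 4 = x1 + x2 + b"
    unfolding e34 e13 e14 by (simp_all add: algebra_simps)
qed

end

text \<open>Row i of \<open>varpi_e23\<close> holds the coefficients of
  \<open>eU i 5 * eU 2 3\<close> over \<open>e_5\<close>, obtained by moving \<open>eU 2 3\<close>
  to the left; likewise for \<open>varpi_e12\<close>. That these are the values of
  \<open>varpi\<close> is verified in \<open>is_varpi_e23\<close> and
  \<open>is_varpi_e12\<close>.\<close>

definition varpi_e23 :: "'k::comm_ring_1 Up5 ^ 3 ^ 3" where
  "varpi_e23 = vector [vector [eU 2 3, 0, 0], vector [0, eU 2 3 + eU 3 5, - eU 2 5],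
     vector [0, - eU 3 5, eU 2 3 + eU 2 5]]"

definition varpi_e12 :: "'k::comm_ring_1 Up5 ^ 3 ^ 3" where
  "varpi_e12 = vector [vector [eU 1 2 + eU 2 5, - eU 1 5, 0],
     vector [- eU 2 5, eU 1 2 + eU 1 5, 0], vector [0, 0, eU 1 2]]"

text \<open>\<open>fox_row i j\<close> and \<open>fox_block i j\<close> are \<open>D(e\<^sub>i\<^sub>j)\<close> and \<open>varpi (\<sigma> e\<^sub>i\<^sub>j)\<close>; the rows are read off
  the expressions of the \<open>e\<^sub>i\<^sub>j\<close> in \<open>eU_eqs\<close>.\<close>

definition fox_block :: "nat \<Rightarrow> nat \<Rightarrow> 'k::comm_ring_1 Up5 ^ 3 ^ 3" where
  "fox_block i j =
     (if 5 \<in> {i, j} then 0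
      else if {i, j} \<in> {{1, 4}, {2, 3}} then varpi_e23
      else if {i, j} \<in> {{1, 2}, {3, 4}} then varpi_e12
      else - varpi_e23 - varpi_e12)"

definition fox_row :: "nat \<Rightarrow> nat \<Rightarrow> 'k::comm_ring_1 Up5 ^ 3" where
  "fox_row i j =
     (if {i, j} = {1, 5} then vector [1, 0, 0]
      else if {i, j} = {2, 5} then vector [0, 1, 0]
      else if {i, j} = {3, 5} then vector [0, 0, 1]
      else if {i, j} \<in> {{4, 5}, {1, 3}} then vector [-1, -1, -1]
      else if {i, j} = {1, 4} then vector [0, 1, 1]
      else if {i, j} = {2, 4} then vector [0, -1, 0]
      else if {i, j} = {3, 4} then vector [1, 1, 0]
      else 0)"

definition fox :: "nat \<Rightarrow> nat \<Rightarrow> 'k::comm_ring_1 Up5 tri" where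
  "fox i j = Tri (eU i j) (fox_row i j) (fox_block i j)"

lemma fox_symm: "i \<in> {1..5} \<Longrightarrow> j \<in> {1..5} \<Longrightarrow> i \<noteq> j \<Longrightarrow> fox i j = fox j i"
  unfolding fox_def fox_row_def fox_block_def insert_commute[of i j "{}"]
  by (simp only: tri.inject simp_thms) (rule eU_symm)

lemma corner_sum: "corner (sum f A) = (\<Sum>x\<in>A. corner (f x))"
  and top_row_sum: "top_row (sum f A) = (\<Sum>x\<in>A. top_row (f x))"
  and block_sum: "block (sum f A) = (\<Sum>x\<in>A. block (f x))"
  by (induction A rule: infinite_finite_induct; simp add: zero_tri_def plus_tri_def)+

lemma fox_sum:
  assumes "i \<in> {1..5}"
  shows "(\<Sum>j\<in>{1..5}-{i}. fox i j) = 0"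
proof -
  have "(\<Sum>j\<in>{1..5}-{i}. fox_row i j) = 0" "(\<Sum>j\<in>{1..5}-{i}. fox_block i j) = 0"
    using assms unfolding one_to_five
    by (auto simp: fox_row_def fox_block_def insert_Diff_if doubleton_eq_iff vec_eq_iff forall_3)
  with eU_sum[OF assms] show ?thesis
    by (intro tri.expand) (simp add: zero_tri_def corner_sum top_row_sum block_sum fox_def)
qed

lemma fox_row_table:
  "fox_row 1 2 = 0" "fox_row 1 3 = vector [-1, -1, -1]" "fox_row 1 4 = vector [0, 1, 1]"
  "fox_row 1 5 = vector [1, 0, 0]" "fox_row 2 3 = 0" "fox_row 2 4 = vector [0, -1, 0]"
  "fox_row 2 5 = vector [0, 1, 0]" "fox_row 3 4 = vector [1, 1, 0]"
  "fox_row 3 5 = vector [0, 0, 1]" "fox_row 4 5 = vector [-1, -1, -1]"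
  by (simp_all add: fox_row_def doubleton_eq_iff)

lemma fox_block_table:
  "fox_block 1 2 = varpi_e12" "fox_block 1 3 = - varpi_e23 - varpi_e12"
  "fox_block 1 4 = varpi_e23" "fox_block 1 5 = 0" "fox_block 2 3 = varpi_e23"
  "fox_block 2 4 = - varpi_e23 - varpi_e12" "fox_block 2 5 = 0" "fox_block 3 4 = varpi_e12"
  "fox_block 3 5 = 0" "fox_block 4 5 = 0"
  by (simp_all add: fox_block_def doubleton_eq_iff)

text \<open>Ordering the pairs leaves the 15 unordered couples of disjoint pairs from five indices.
  The corners commute by \<open>eU_comm\<close>, so the work lies in the rows and blocks.\<close>

lemma fox_comm_ordered:
  assumes h: "rat_algebra_map (h :: rat \<Rightarrow> 'k::comm_ring_1)"
    and ijkl: "i \<in> {1..5}" "j \<in> {1..5}" "k \<in> {1..5}" "l \<in> {1..5}" "distinct [i, j, k, l]"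
    and "i < j" "k < l" "i < k"
  shows "fox i j * fox k l = (fox k l * fox i j :: 'k Up5 tri)"
proof -
  have cases: "(i, j, k, l) \<in> {(1,2,3,4), (1,2,3,5), (1,2,4,5), (1,3,2,4), (1,3,2,5), (1,3,4,5),
      (1,4,2,3), (1,4,2,5), (1,4,3,5), (1,5,2,3), (1,5,2,4), (1,5,3,4), (2,3,4,5), (2,4,3,5),
      (2,5,3,4)}"
  proof -
    have "i \<in> {1, 2}" "j \<in> {2, 3, 4, 5}" "k \<in> {2, 3, 4}" "l \<in> {3, 4, 5}"
      using assms(2-) by auto
    with assms(6-) show ?thesis by (elim insertE emptyE) simp_all
  qed
  \<comment> \<open>After substitution of \<open>eU_eqs\<close> both rows consist of noncommutative
    polynomials in five generators, which agree by ring identities alone.\<close>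
  have "top_row (fox i j * fox k l) = top_row (fox k l * fox i j :: 'k Up5 tri)"
    using cases
    by (elim insertE emptyE; simp add: fox_def fox_row_table fox_block_table times_tri_def
        vec_eq_iff forall_3 sum_3 varpi_e12_def varpi_e23_def eU_eqs[OF h] algebra_simps
        del: One_nat_def)
  \<comment> \<open>A pair containing 5 has block 0, and complementary pairs in {1,2,3,4} have the
    same image under the projection killing the index 5, so two different nonzero blocks never
    meet.\<close>
  moreover have "fox_block i j = (0 :: 'k Up5 ^ 3 ^ 3) \<or> fox_block k l = (0 :: 'k Up5 ^ 3 ^ 3) \<or>
      fox_block i j = (fox_block k l :: 'k Up5 ^ 3 ^ 3)"
    using cases by (elim insertE emptyE; simp add: fox_block_table del: One_nat_def)
  then have "block (fox i j * fox k l) = block (fox k l * fox i j :: 'k Up5 tri)"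
    by (auto simp: fox_def times_tri_def)
  moreover have "corner (fox i j * fox k l) = corner (fox k l * fox i j :: 'k Up5 tri)"
    using eU_comm[OF ijkl] by (simp add: fox_def times_tri_def)
  ultimately show ?thesis
    by (simp add: tri.expand)
qed

lemma fox_comm:
  assumes h: "rat_algebra_map (h :: rat \<Rightarrow> 'k::comm_ring_1)"
    and ijkl: "i \<in> {1..5}" "j \<in> {1..5}" "k \<in> {1..5}" "l \<in> {1..5}" "distinct [i, j, k, l]"
  shows "fox i j * fox k l = (fox k l * fox i j :: 'k Up5 tri)"
proof -
  have ord: "fox i j * fox k l = (fox k l * fox i j :: 'k Up5 tri)"
    if "i \<in> {1..5}" "j \<in> {1..5}" "k \<in> {1..5}" "l \<in> {1..5}" "distinct [i, j, k, l]"
      "i < j" "k < l" for i j k l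
  proof (cases "i < k")
    case True
    with that show ?thesis by (intro fox_comm_ordered[OF h])
  next
    case False
    with that show ?thesis by (intro fox_comm_ordered[OF h, symmetric]) auto
  qed
  define m n where "m = min i j" "n = max i j"
  define p q where "p = min k l" "q = max k l"
  have "fox i j = (fox m n :: 'k Up5 tri)" "fox k l = (fox p q :: 'k Up5 tri)"
    using fox_symm[of i j] fox_symm[of k l] ijkl by (auto simp: m_n_def p_q_def min_def max_def)
  moreover have "fox m n * fox p q = (fox p q * fox m n :: 'k Up5 tri)"
    using ijkl by (intro ord) (auto simp: m_n_def p_q_def min_def max_def)
  ultimately show ?thesis by simp
qed

text \<open>The top row of \<open>F\<close> is a left inverse of the map sending coefficients to
  their combination of \<open>e_5\<close>. The corner of \<open>F\<close> is the identity, the block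
  of \<open>eU j 5\<close> is 0 and its row is the j-th unit vector, so the product rule reads off
  the coefficient of \<open>eU j 5\<close>.\<close>

theorem e_5_independent:
  fixes c d :: "'k::comm_ring_1 Up5 ^ 3"
  assumes h: "rat_algebra_map (h :: rat \<Rightarrow> 'k)"
    and eq: "(\<Sum>j\<in>UNIV. c $ j * e_5 $ j) = (\<Sum>j\<in>UNIV. d $ j * e_5 $ j)"
  shows "c = d"
proof -
  obtain F :: "'k Up5 \<Rightarrow> 'k Up5 tri" where F: "\<And>u v. F (u + v) = F u + F v"
    "\<And>u v. F (u * v) = F u * F v" "\<And>c u. F (Up5_scale c u) = tri_scale c (F u)" "F 1 = 1"
    and F_eU: "\<And>i j. i \<in> {1..5} \<Longrightarrow> j \<in> {1..5} \<Longrightarrow> i \<noteq> j \<Longrightarrow> F (eU i j) = fox i j"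
    using tri.Up5_universal[of fox, OF fox_symm fox_sum fox_comm[OF h]] by blast
  have corner: "corner (F u) = u" for u
    by (induction u rule: Up5_induct)
      (simp_all add: F F_eU fox_def one_tri_def plus_tri_def times_tri_def tri_scale_def)
  have "F (eU 1 5) = fox 1 5" "F (eU 2 5) = fox 2 5" "F (eU 3 5) = fox 3 5"
    by (rule F_eU; simp)+
  then have "top_row (F (\<Sum>j\<in>UNIV. a $ j * e_5 $ j)) = a" for a
    by (simp add: F sum_3 e_5_def corner fox_def fox_row_table fox_block_table times_tri_def
        plus_tri_def vec_eq_iff forall_3 del: One_nat_def)
  with eq show ?thesis by metis
qed

section \<open>The matrices varpi and rho\<close>

text \<open>The defining property of \<open>varpi\<close> without the description operator, so that
  existence can be built up along products and sums separately from uniqueness.\<close>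

definition is_varpi :: "'k::comm_ring_1 Up5 \<Rightarrow> 'k Up5 ^ 3 ^ 3 \<Rightarrow> bool" where
  "is_varpi p A \<longleftrightarrow> (\<forall>i. e_5 $ i * p = (\<Sum>j\<in>UNIV. A $ i $ j * e_5 $ j))"

lemma varpi_eqI:
  assumes h: "rat_algebra_map (h :: rat \<Rightarrow> 'k::comm_ring_1)" and "is_varpi p (A :: 'k Up5 ^ 3 ^ 3)"
  shows "varpi p = A"
  unfolding varpi_def
proof (rule the_equality)
  fix B :: "'k Up5 ^ 3 ^ 3"
  assume "\<forall>i. e_5 $ i * p = (\<Sum>j\<in>UNIV. B $ i $ j * e_5 $ j)"
  with assms(2) have "B $ i = A $ i" for i
    by (intro e_5_independent[OF h]) (simp add: is_varpi_def)
  then show "B = A" by (simp add: vec_eq_iff)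
qed (use assms(2) in \<open>simp add: is_varpi_def\<close>)

lemma is_varpi_one: "is_varpi 1 (mat 1)"
  by (simp add: is_varpi_def sum_3 forall_3 mat_def)

lemma is_varpi_add: "is_varpi p A \<Longrightarrow> is_varpi q B \<Longrightarrow> is_varpi (p + q) (A + B)"
  by (simp add: is_varpi_def distrib_left distrib_right sum.distrib)

lemma is_varpi_scale:
  "is_varpi p A \<Longrightarrow> is_varpi (Up5_scale c p) (map_matrix (Up5_scale c) A)"
  by (simp add: is_varpi_def map_matrix_def Up5.left Up5.right Up5_module.scale_sum_right)

lemma is_varpi_mult:
  assumes "is_varpi p A" "is_varpi q B"
  shows "is_varpi (p * q) (A ** B)"
  unfolding is_varpi_def
proof
  fix i
  have "e_5 $ i * (p * q) = (\<Sum>j\<in>UNIV. A $ i $ j * (e_5 $ j * q))"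
    using assms(1) by (simp add: is_varpi_def sum_distrib_right mult.assoc flip: mult.assoc[of _ p q])
  also have "\<dots> = (\<Sum>j\<in>UNIV. \<Sum>k\<in>UNIV. A $ i $ j * B $ j $ k * e_5 $ k)"
    using assms(2) by (simp add: is_varpi_def sum_distrib_left mult.assoc)
  also have "\<dots> = (\<Sum>k\<in>UNIV. (A ** B) $ i $ k * e_5 $ k)"
    by (subst sum.swap) (simp add: matrix_matrix_mult_def sum_distrib_right)
  finally show "e_5 $ i * (p * q) = (\<Sum>k\<in>UNIV. (A ** B) $ i $ k * e_5 $ k)" .
qed

text \<open>Turns a commutation relation with a sum into a rule moving \<open>a\<close> to the left
  of \<open>x\<close>. The sums will be \<open>eU 1 4\<close> and \<open>eU 3 4\<close> as expanded
  by \<open>eU_eqs\<close>.\<close>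

lemma swap_of_commuting_sum:
  fixes x y a :: "'a::ring"
  assumes "(x + y + a) * x = x * (x + y + a)"
  shows "x * a = a * x + y * x - x * y"
proof -
  have "x * a - (a * x + y * x - x * y) = x * (x + y + a) - (x + y + a) * x"
    by (simp add: algebra_simps)
  then show ?thesis using assms by simp
qed

text \<open>Row 1 holds because \<open>eU 1 5\<close> and \<open>eU 2 3\<close> commute. Rows 2 and
  3 come from \<open>eU 1 4\<close>, the sum of \<open>eU 2 5\<close>, \<open>eU 3 5\<close> and
  \<open>eU 2 3\<close>, commuting with \<open>eU 2 5\<close> and \<open>eU 3 5\<close>.\<close>

lemma is_varpi_e23:
  assumes h: "rat_algebra_map (h :: rat \<Rightarrow> 'k::comm_ring_1)"
  shows "is_varpi (eU 2 3) (varpi_e23 :: 'k Up5 ^ 3 ^ 3)"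
proof -
  have "eU 1 4 * eU 2 5 = (eU 2 5 * eU 1 4 :: 'k Up5)" "eU 1 4 * eU 3 5 = (eU 3 5 * eU 1 4 :: 'k Up5)"
    and x1: "eU 1 5 * eU 2 3 = (eU 2 3 * eU 1 5 :: 'k Up5)"
    by (rule eU_comm; simp)+
  then have
    "(eU 2 5 + eU 3 5 + eU 2 3) * eU 2 5 = (eU 2 5 * (eU 2 5 + eU 3 5 + eU 2 3) :: 'k Up5)"
    "(eU 3 5 + eU 2 5 + eU 2 3) * eU 3 5 = (eU 3 5 * (eU 3 5 + eU 2 5 + eU 2 3) :: 'k Up5)"
    by (simp_all only: eU_eqs[OF h] add.commute[of "eU 3 5" "eU 2 5"])
  note this[THEN swap_of_commuting_sum]
  with x1 show ?thesis
    by (simp add: is_varpi_def varpi_e23_def e_5_def sum_3 forall_3 distrib_right del: One_nat_def)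
qed

text \<open>The same argument with \<open>eU 3 4\<close>, the sum of \<open>eU 1 5\<close>,
  \<open>eU 2 5\<close> and \<open>eU 1 2\<close>, in place of \<open>eU 1 4\<close>.\<close>

lemma is_varpi_e12:
  assumes h: "rat_algebra_map (h :: rat \<Rightarrow> 'k::comm_ring_1)"
  shows "is_varpi (eU 1 2) (varpi_e12 :: 'k Up5 ^ 3 ^ 3)"
proof -
  have "eU 3 4 * eU 1 5 = (eU 1 5 * eU 3 4 :: 'k Up5)" "eU 3 4 * eU 2 5 = (eU 2 5 * eU 3 4 :: 'k Up5)"
    and x3: "eU 3 5 * eU 1 2 = (eU 1 2 * eU 3 5 :: 'k Up5)"
    by (rule eU_comm; simp)+
  then have
    "(eU 1 5 + eU 2 5 + eU 1 2) * eU 1 5 = (eU 1 5 * (eU 1 5 + eU 2 5 + eU 1 2) :: 'k Up5)"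
    "(eU 2 5 + eU 1 5 + eU 1 2) * eU 2 5 = (eU 2 5 * (eU 2 5 + eU 1 5 + eU 1 2) :: 'k Up5)"
    by (simp_all only: eU_eqs[OF h] add.commute[of "eU 2 5" "eU 1 5"])
  note this[THEN swap_of_commuting_sum]
  with x3 show ?thesis
    by (simp add: is_varpi_def varpi_e12_def e_5_def sum_3 forall_3 distrib_right del: One_nat_def)
qed

lemmas ell_simps =
  Up5.free_lift_add[of "\<lambda>x. case x of X0 \<Rightarrow> eU 2 3 | X1 \<Rightarrow> eU 1 2", folded ell_def]
  Up5.free_lift_kscale[of "\<lambda>x. case x of X0 \<Rightarrow> eU 2 3 | X1 \<Rightarrow> eU 1 2", folded ell_def]
  Up5.free_lift_mult[of "\<lambda>x. case x of X0 \<Rightarrow> eU 2 3 | X1 \<Rightarrow> eU 1 2", folded ell_def]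
  Up5.free_lift_one[of "\<lambda>x. case x of X0 \<Rightarrow> eU 2 3 | X1 \<Rightarrow> eU 1 2", folded ell_def]
  Up5.free_lift_gen[of "\<lambda>x. case x of X0 \<Rightarrow> eU 2 3 | X1 \<Rightarrow> eU 1 2", folded ell_def]

text \<open>The image of \<open>ell\<close> is generated by \<open>eU 2 3\<close> and
  \<open>eU 1 2\<close>, so their two matrices yield existence on all of it; uniqueness then
  identifies the matrix with \<open>varpi\<close>.\<close>

lemma is_varpi_ell:
  fixes a :: "'k::comm_ring_1 V"
  assumes h: "rat_algebra_map (h :: rat \<Rightarrow> 'k)"
  shows "is_varpi (ell a) (varpi (ell a))"
proof -
  have "\<exists>A. is_varpi (ell a) A"
  proof (induction a rule: free_algebra_induct)
    case (scalar c)
    show ?case using is_varpi_scale[OF is_varpi_one, of c] by (auto simp: ell_simps)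
  next
    case (gen x g)
    then obtain A where A: "is_varpi (ell x) A" ..
    show ?case
      using is_varpi_mult[OF A is_varpi_e23[OF h]] is_varpi_mult[OF A is_varpi_e12[OF h]]
      by (cases g) (auto simp: ell_simps simp del: One_nat_def)
  next
    case (add x z)
    then show ?case by (auto simp: ell_simps intro: is_varpi_add)
  qed
  then show ?thesis using varpi_eqI[OF h] by blast
qed

section \<open>Images under pr12 and the values of rho\<close>

definition e0T :: "'k::comm_ring_1 V2" where "e0T = e0 \<otimes>\<^sub>t 1"
definition f0T :: "'k::comm_ring_1 V2" where "f0T = 1 \<otimes>\<^sub>t e0"

lemma tensor_diff_left: "(x - x') \<otimes>\<^sub>t z = x \<otimes>\<^sub>t z - x' \<otimes>\<^sub>t z"
  and tensor_uminus_left: "(- x) \<otimes>\<^sub>t z = - (x \<otimes>\<^sub>t z)"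
  and tensor_uminus_right: "x \<otimes>\<^sub>t (- z) = - (x \<otimes>\<^sub>t z)"
  by (rule poly_mapping_eqI; auto simp: lookup_tensor lookup_minus algebra_simps)+

lemma pr12_zero: "pr12 0 = 0"
  using pr12_facts(1)[of 0 0] by simp

lemma pr12_uminus: "pr12 (- u) = - pr12 u"
  using pr12_facts(1)[of u "- u"] by (simp add: pr12_zero eq_neg_iff_add_eq_0 add.commute)

lemma pr12_eU:
  assumes "i \<in> {1..5}" "j \<in> {1..5}" "i \<noteq> j"
  shows "pr12 (eU i j :: 'k::comm_ring_1 Up5) = pr1_gen (i, j) \<otimes>\<^sub>t 1 + 1 \<otimes>\<^sub>t pr2_gen (i, j)"
  using pr12_facts(5)[of "p5_e i j :: 'k p5"] pr1_facts(6)[OF assms, where 'k='k]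
    pr2_facts(6)[OF assms, where 'k='k]
  by (simp add: eU_def)

lemma pr12_eU_table:
  "pr12 (eU 1 2) = 0" "pr12 (eU 2 3) = e0T" "pr12 (eU 1 5) = f1T" "pr12 (eU 2 5) = e1T"
  "pr12 (eU 3 5) = - e0T - e1T + f0T"
  using pr12_eU[of 1 2] pr12_eU[of 2 3] pr12_eU[of 1 5] pr12_eU[of 2 5] pr12_eU[of 3 5]
  by (simp_all add: pr1_gen_def pr2_gen_def doubleton_eq_iff tensor_zero e_inf_def tensor_diff_left
      tensor_uminus_left e0T_def e1T_def f0T_def f1T_def)

context
  fixes h :: "rat \<Rightarrow> 'k::comm_ring_1"
  assumes h: "rat_algebra_map h"
begin

lemma rho_eqI:
  fixes a :: "'k V"
  assumes "is_varpi (ell a) A"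
  shows "rho a = map_matrix pr12 A"
  by (simp add: rho_def varpi_eqI[OF h assms])

lemma rho_one: "rho (1 :: 'k V) = mat 1"
  using rho_eqI[of 1 "mat 1", unfolded ell_simps, OF is_varpi_one]
  by (simp add: map_matrix_def mat_def vec_eq_iff pr12_facts(4) pr12_zero)

lemma rho_add: "rho (a + b :: 'k V) = rho a + rho b"
  using rho_eqI[of "a + b", unfolded ell_simps, OF is_varpi_add[OF is_varpi_ell[OF h] is_varpi_ell[OF h]]]
  by (simp add: rho_def map_matrix_def vec_eq_iff pr12_facts(1))

lemma rho_kscale: "rho (kscale c a :: 'k V) = M3_scale c (rho a)"
  using rho_eqI[of "kscale c a", unfolded ell_simps, OF is_varpi_scale[OF is_varpi_ell[OF h]]]
  by (simp add: rho_def M3_scale_def map_matrix_def vec_eq_iff pr12_facts(3))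

lemma rho_mult: "rho (a * b :: 'k V) = rho a ** rho b"
  using rho_eqI[of "a * b", unfolded ell_simps, OF is_varpi_mult[OF is_varpi_ell[OF h] is_varpi_ell[OF h]]]
  by (simp add: rho_def map_matrix_def matrix_matrix_mult_def vec_eq_iff sum_3 pr12_facts(1,2))

lemma rho_e0: "rho (e0 :: 'k V) =
  vector [vector [e0T, 0, 0], vector [0, f0T - e1T, - e1T], vector [0, e0T + e1T - f0T, e0T + e1T]]"
  using rho_eqI[of e0, unfolded e0_def ell_simps letter.case, OF is_varpi_e23[OF h]]
  by (simp add: e0_def varpi_e23_def map_matrix_def vec_eq_iff forall_3 pr12_facts(1) pr12_zero pr12_uminus
      pr12_eU_table)

text \<open>Since \<open>pr12\<close> kills \<open>eU 1 2\<close>, only the off-diagonal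
  contributions of \<open>varpi_e12\<close> and their diagonal partners survive, and what remains
  factors through rank one.\<close>

lemma rho_e1: "rho (e1 :: 'k V) = col1 ** row1"
  using rho_eqI[of e1, unfolded e1_def ell_simps letter.case, OF is_varpi_e12[OF h]]
  by (simp add: e1_def varpi_e12_def map_matrix_def vec_eq_iff forall_3 pr12_facts(1) pr12_zero pr12_uminus
      pr12_eU_table col1_def row1_def matrix_matrix_mult_def forall_1 sum_1 del: One_nat_def)

end

section \<open>The identity before localization\<close>

definition W_code :: "nat list \<Rightarrow> letter list" where
  "W_code l = concat (map (\<lambda>m. replicate m X0 @ [X1]) l)"

lemma replicate_X0_X1_eq:
  "replicate m X0 @ X1 # u = replicate n X0 @ X1 # v \<longleftrightarrow> m = n \<and> u = v"
proof (induction m arbitrary: n)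
  case 0
  show ?case by (cases n) auto
next
  case (Suc m)
  then show ?case by (cases n) auto
qed

text \<open>The blocks \<open>X0 ... X0 X1\<close> form a prefix code: the first \<open>X1\<close>
  marks the end of the first block. This is the freeness of \<open>W\<close> on the level of
  words.\<close>

lemma W_code_eq_iff: "W_code l = W_code l' \<longleftrightarrow> l = l'"
proof (induction l arbitrary: l')
  case Nil
  show ?case by (cases l') (auto simp: W_code_def)
next
  case (Cons m l)
  then show ?case
    by (cases l') (auto simp: W_code_def replicate_X0_X1_eq)
qed

lemma e0_power: "(e0 :: 'k::comm_ring_1 V) ^ n = Poly_Mapping.single (Word (replicate n X0)) 1"
proof (induction n)
  case 0
  show ?case by (simp flip: zero_word_def)
next
  case (Suc n)
  then show ?case by (simp add: e0_def gen_def mult_single plus_word_def)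
qed

lemma y_W_single: "y_W (Suc m) = Poly_Mapping.single (Word (replicate m X0 @ [X1])) (- 1)"
  by (simp add: y_W_def e0_power e1_def gen_def mult_single plus_word_def single_uminus)

lemma W_pres_single:
  fixes c :: "'k::comm_ring_1"
  shows "W_pres (Poly_Mapping.single (Word l) c) =
    Poly_Mapping.single (Word (W_code l)) (c * (- 1) ^ length l)"
proof -
  have "prod_list (map (\<lambda>m. y_W (Suc m)) l) =
      (Poly_Mapping.single (Word (W_code l)) ((- 1) ^ length l) :: 'k V)"
    by (induction l)
      (simp_all add: W_code_def y_W_single mult_single plus_word_def flip: zero_word_def)
  then show ?thesis
    by (simp add: W_pres_def free_lift_def module.linear_lift_single[OF module_kscale] kscale_single)
qed

lemmas W_pres_simps =
  kscale_algebra.free_lift_add[of "\<lambda>m. y_W (Suc m)", folded W_pres_def]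
  kscale_algebra.free_lift_zero[of "\<lambda>m. y_W (Suc m)", folded W_pres_def]
  kscale_algebra.free_lift_diff[of "\<lambda>m. y_W (Suc m)", folded W_pres_def]
  kscale_algebra.free_lift_kscale[of "\<lambda>m. y_W (Suc m)", folded W_pres_def]
  kscale_algebra.free_lift_mult[of "\<lambda>m. y_W (Suc m)", folded W_pres_def]
  kscale_algebra.free_lift_one[of "\<lambda>m. y_W (Suc m)", folded W_pres_def]
  kscale_algebra.free_lift_gen[of "\<lambda>m. y_W (Suc m)", folded W_pres_def]

lemma lookup_W_pres:
  "Poly_Mapping.lookup (W_pres x) (Word (W_code l)) = (- 1) ^ length l * Poly_Mapping.lookup x (Word l)"
proof (induction x rule: pm_induct)
  case (2 u c)
  then show ?case
    by (cases u) (auto simp: W_pres_single lookup_single when_def W_code_eq_iff)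
qed (simp_all add: W_pres_simps lookup_add algebra_simps)

lemma inj_W_pres: "inj (W_pres :: _ \<Rightarrow> 'k::comm_ring_1 V)"
proof (rule injI)
  fix x x' :: "nat word \<Rightarrow>\<^sub>0 'k"
  assume "W_pres x = W_pres x'"
  then have "(- 1) ^ length l * Poly_Mapping.lookup x (Word l) =
      (- 1) ^ length l * Poly_Mapping.lookup x' (Word l)" for l
    by (metis lookup_W_pres)
  \<comment> \<open>The sign squares to 1, so a second multiplication removes it over any
    commutative ring.\<close>
  then have "(- 1) ^ length l * ((- 1) ^ length l * Poly_Mapping.lookup x (Word l)) =
      (- 1) ^ length l * ((- 1) ^ length l * Poly_Mapping.lookup x' (Word l))" for l
    by metis
  then have "Poly_Mapping.lookup x (Word l) = Poly_Mapping.lookup x' (Word l)" for l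
    by (simp flip: mult.assoc power_mult_distrib)
  then show "x = x'"
    by (metis poly_mapping_eqI word.exhaust)
qed

text \<open>The coproduct on the presentation of \<open>W\<close>, where it is a morphism on the
  whole algebra and \<open>inv W_pres\<close> does not appear.\<close>

definition Delta_pres :: "(nat word \<Rightarrow>\<^sub>0 'k::comm_ring_1) \<Rightarrow> 'k V2" where
  "Delta_pres = free_lift kscale (\<lambda>m. Delta_y (Suc m))"

lemmas Delta_pres_simps =
  kscale_algebra.free_lift_add[of "\<lambda>m. Delta_y (Suc m)", folded Delta_pres_def]
  kscale_algebra.free_lift_zero[of "\<lambda>m. Delta_y (Suc m)", folded Delta_pres_def]
  kscale_algebra.free_lift_diff[of "\<lambda>m. Delta_y (Suc m)", folded Delta_pres_def]
  kscale_algebra.free_lift_kscale[of "\<lambda>m. Delta_y (Suc m)", folded Delta_pres_def]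
  kscale_algebra.free_lift_mult[of "\<lambda>m. Delta_y (Suc m)", folded Delta_pres_def]
  kscale_algebra.free_lift_one[of "\<lambda>m. Delta_y (Suc m)", folded Delta_pres_def]
  kscale_algebra.free_lift_gen[of "\<lambda>m. Delta_y (Suc m)", folded Delta_pres_def]

lemma Delta_W_W_pres: "Delta_W (W_pres x) = Delta_pres x"
  by (simp add: Delta_W_def Delta_pres_def inv_f_f[OF inj_W_pres])

lemma W_pres_mult_gen: "W_pres (x * gen m) = - (W_pres x * e0 ^ m * e1)"
  by (simp add: W_pres_simps y_W_def mult.assoc)

text \<open>Each word splits into a part that is empty or ends in \<open>X1\<close> and a final run
  of \<open>X0\<close>; the first part lies in the image of \<open>W_pres\<close> up to a
  scalar.\<close>

lemma V_induct_W_pres [case_names base add]: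
  fixes a :: "'k::comm_ring_1 V"
  assumes base: "\<And>x m. P (W_pres x * e0 ^ m)"
    and add: "\<And>a b. P a \<Longrightarrow> P b \<Longrightarrow> P (a + b)"
  shows "P a"
proof (induction a rule: pm_induct)
  case 1
  show ?case using base[of 0] by (simp add: W_pres_simps)
next
  case (2 u c)
  have "\<exists>x m. Poly_Mapping.single (Word l) c = W_pres x * e0 ^ m" for l
  proof (induction l rule: rev_induct)
    case Nil
    have "Poly_Mapping.single (Word []) c = W_pres (Poly_Mapping.single (Word []) c) * e0 ^ 0"
      by (simp add: W_pres_single W_code_def)
    then show ?case by blast
  next
    case (snoc g l)
    then obtain x m where xm: "Poly_Mapping.single (Word l) c = W_pres x * e0 ^ m" by blast
    have *: "Poly_Mapping.single (Word (l @ [g])) c = W_pres x * e0 ^ m * gen g"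
      by (simp add: gen_def mult_single plus_word_def flip: xm)
    show ?case
    proof (cases g)
      case X0
      with * have "Poly_Mapping.single (Word (l @ [g])) c = W_pres x * e0 ^ Suc m"
        by (simp add: mult.assoc power_Suc2 flip: e0_def del: power_Suc)
      then show ?thesis by blast
    next
      case X1
      \<comment> \<open>A final \<open>X1\<close> closes the run of \<open>e0\<close> into one more
        generator of \<open>W\<close>, with the sign of \<open>y_W\<close>. Negation is treated as
        subtraction from 0, for which a rule of \<open>W_pres\<close> is at hand.\<close>
      with * have "Poly_Mapping.single (Word (l @ [g])) c = W_pres (- (x * gen m)) * e0 ^ 0"
        using W_pres_simps(3)[of 0 "x * gen m"]
        by (simp add: W_pres_mult_gen W_pres_simps(2) flip: e1_def)
      then show ?thesis by blast
    qed
  qed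
  then show ?case using base by (cases u) metis
qed (rule add)

text \<open>\<open>Delta_W\<close> is computed through \<open>inv W_pres\<close>, so its rules apply
  only to arguments known to lie in this range.\<close>

lemma mult_e1_in_range_W_pres: "a * e1 \<in> range W_pres"
proof (induction a rule: V_induct_W_pres)
  case (base x m)
  have "W_pres x * e0 ^ m * e1 = W_pres (- (x * gen m))"
    using W_pres_simps(3)[of 0 "x * gen m"] by (simp add: W_pres_mult_gen W_pres_simps(2))
  then show ?case by blast
next
  case (add a b)
  then obtain x z where "a * e1 = W_pres x" "b * e1 = W_pres z" by auto
  then have "(a + b) * e1 = W_pres (x + z)" by (simp add: distrib_right W_pres_simps)
  then show ?case by blast
qed

lemma W_plus_subset_range_W_pres: "W_plus \<subseteq> range W_pres"
  using mult_e1_in_range_W_pres by (auto simp: W_plus_def)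

lemma Delta_W_hom:
  assumes "x \<in> range W_pres" "z \<in> range W_pres"
  shows "Delta_W (x + z) = Delta_W x + Delta_W z"
    and "Delta_W (x * z) = Delta_W x * Delta_W z"
  using assms by (auto simp: Delta_W_W_pres Delta_pres_simps simp flip: W_pres_simps)

lemma Delta_W_kscale: "x \<in> range W_pres \<Longrightarrow> Delta_W (kscale c x) = kscale c (Delta_W x)"
  by (auto simp: Delta_W_W_pres Delta_pres_simps simp flip: W_pres_simps)

section \<open>The row-column pairing and its values on powers of e0\<close>

lemma e1T_f1T: "e1T * f1T = e1 \<otimes>\<^sub>t e1"
  by (simp add: e1T_def f1T_def tensor_mult)

definition row_col :: "'k::comm_ring_1 V2 ^ 3 ^ 3 \<Rightarrow> 'k V2" where
  "row_col X = (row1 ** X ** col1) $ 1 $ 1"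

lemma row_col_expand: "row_col X = e1T * (X $ 1 $ 1 - X $ 1 $ 2) - f1T * (X $ 2 $ 1 - X $ 2 $ 2)"
  by (simp add: row_col_def row1_def col1_def matrix_matrix_mult_def sum_3 algebra_simps)

lemma row_col_add: "row_col (X + Y) = row_col X + row_col Y"
  by (simp add: row_col_expand algebra_simps)

lemma row_col_M3_scale: "row_col (M3_scale c X) = kscale c (row_col X)"
  by (simp add: row_col_expand M3_scale_def map_matrix_def kscale_mult_right
      module.scale_right_diff_distrib[OF module_kscale] right_diff_distrib)

text \<open>By associativity the product splits into two 1 by 1 matrices. With
  \<open>rho_e1\<close>, the pairing of \<open>rho (a * e1 * b)\<close> factors into those at
  \<open>a\<close> and \<open>b\<close>.\<close>

lemma row_col_mult_col1_row1: "row_col (X ** (col1 ** row1) ** Y) = row_col X * row_col Y"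
proof -
  have "row1 ** (X ** (col1 ** row1) ** Y) ** col1 = (row1 ** X ** col1) ** (row1 ** Y ** col1)"
    by (simp add: matrix_mul_assoc)
  then show ?thesis
    by (simp add: row_col_def) (simp add: matrix_matrix_mult_def[of "row1 ** X ** col1"])
qed

text \<open>Minus the second entry of \<open>rho (e0 ^ n) ** col1\<close>, in closed form. The sum
  solves the recursion \<open>f_part_Suc\<close>, each step shifting the old terms by
  \<open>f0T\<close> and adding the term \<open>k = n + 1\<close>.\<close>

definition f_part :: "nat \<Rightarrow> 'k::comm_ring_1 V2" where
  "f_part n = 1 \<otimes>\<^sub>t e0 ^ n - (\<Sum>k = 1..n. (e1 * e0 ^ (k - 1)) \<otimes>\<^sub>t e0 ^ (n - k))"

lemma f_part_Suc: "f_part (Suc n) = f0T * f_part n - e1T * (e0 ^ n \<otimes>\<^sub>t 1)"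
proof -
  have "f0T * (\<Sum>k = 1..n. (e1 * e0 ^ (k - 1)) \<otimes>\<^sub>t e0 ^ (n - k)) =
      (\<Sum>k = 1..n. (e1 * e0 ^ (k - 1)) \<otimes>\<^sub>t (e0 ^ (Suc n - k) :: 'a V))"
    unfolding sum_distrib_left f0T_def
    by (intro sum.cong) (auto simp: tensor_mult Suc_diff_le)
  then show ?thesis
    by (simp add: f_part_def right_diff_distrib f0T_def e1T_def tensor_mult)
qed

context
  fixes h :: "rat \<Rightarrow> 'k::comm_ring_1"
  assumes h: "rat_algebra_map h"
begin

text \<open>The row \<open>(0, 1, 1)\<close> is a left eigenvector of \<open>rho e0\<close> for
  \<open>e0T\<close>, which fixes the sum of the second and third entries as minus
  \<open>e0 ^ n\<close> in the first factor. The second entry then satisfies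
  \<open>f_part_Suc\<close> up to sign.\<close>

lemma rho_e0_power_col1:
  "rho ((e0 :: 'k V) ^ n) ** col1 =
    vector [vector [e0 ^ n \<otimes>\<^sub>t 1], vector [- f_part n], vector [f_part n - e0 ^ n \<otimes>\<^sub>t 1]]"
proof (induction n)
  case 0
  show ?case
    by (simp add: rho_one[OF h] col1_def f_part_def tensor_one vec_eq_iff forall_3)
next
  case (Suc n)
  have "rho ((e0 :: 'k V) ^ Suc n) ** col1 = rho e0 ** (rho (e0 ^ n) ** col1)"
    by (simp add: rho_mult[OF h] matrix_mul_assoc)
  also have "\<dots> = vector [vector [e0 ^ Suc n \<otimes>\<^sub>t 1], vector [- f_part (Suc n)],
      vector [f_part (Suc n) - e0 ^ Suc n \<otimes>\<^sub>t 1]]"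
    unfolding Suc rho_e0[OF h]
    by (simp add: matrix_matrix_mult_def vec_eq_iff forall_3 sum_3 f_part_Suc e0T_def tensor_mult
        algebra_simps)
  finally show ?case .
qed

text \<open>Multiplication by \<open>e1T * f1T\<close> completes each power of \<open>e0\<close> to
  a generator of \<open>W\<close>. The linear terms of \<open>Delta_y\<close> carry one sign of
  \<open>y_W\<close>, the quadratic ones two, which accounts for the minus sign inside
  \<open>f_part\<close> and for the one outside.\<close>

lemma row_col_rho_e0_power: "row_col (rho ((e0 :: 'k V) ^ n)) * (e1T * f1T) = - (e1T * f1T * Delta_y (Suc n))"
proof -
  have "row_col (rho ((e0 :: 'k V) ^ n)) = e1T * (e0 ^ n \<otimes>\<^sub>t 1) + f1T * f_part n"
    by (simp add: row_col_def matrix_mul_assoc[symmetric] rho_e0_power_col1)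
      (simp add: matrix_matrix_mult_def row1_def sum_3)
  then show ?thesis
    unfolding e1T_f1T
    by (simp add: f_part_def Delta_y_def y_W_def distrib_left distrib_right left_diff_distrib
        right_diff_distrib sum_distrib_left sum_distrib_right e1T_def f1T_def tensor_mult
        tensor_uminus_left tensor_uminus_right mult.assoc)
qed

lemma row_col_rho_uminus: "row_col (rho (- a :: 'k V)) = - row_col (rho a)"
  using rho_kscale[OF h, of "- 1" a] row_col_M3_scale[of "- 1" "rho a"]
  by (simp add: module.scale_minus_left[OF module_kscale] module.scale_one[OF module_kscale])

text \<open>The identity multiplied on the left by \<open>e1T * f1T\<close>, so that it can be
  proved in the tensor square of \<open>V\<close> without inverses.\<close>

theorem row_col_rho_e1_f1:
  fixes a :: "'k V"
  shows "row_col (rho a) * (e1T * f1T) = e1T * f1T * Delta_W (a * e1)"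
proof (induction a rule: V_induct_W_pres)
  case (base x m)
  have "row_col (rho (W_pres x * e0 ^ m)) * (e1T * f1T) = - (e1T * f1T * Delta_pres (x * gen m))"
  \<comment> \<open>The exponent is general because the step for a generator \<open>g\<close> uses
    the hypothesis with exponent \<open>g\<close>.\<close>
  proof (induction x arbitrary: m rule: free_algebra_induct)
    case (scalar c)
    show ?case
      by (simp add: W_pres_simps Delta_pres_simps kscale_mult_left kscale_mult_right
          rho_kscale[OF h] row_col_M3_scale row_col_rho_e0_power
          module.scale_minus_right[OF module_kscale])
  next
    case (gen x g)
    have "W_pres (x * gen g) * e0 ^ m = - (W_pres x * e0 ^ g * e1 * e0 ^ m)"
      by (simp add: W_pres_mult_gen)
    then have "row_col (rho (W_pres (x * gen g) * e0 ^ m)) =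
        - (row_col (rho (W_pres x * e0 ^ g)) * row_col (rho (e0 ^ m)))"
      by (simp add: row_col_rho_uminus rho_mult[OF h, of _ "e0 ^ m"] rho_mult[OF h, of _ e1]
          rho_e1[OF h] row_col_mult_col1_row1)
    \<comment> \<open>\<open>row_col_rho_e0_power\<close> carries \<open>e1T * f1T\<close> from the
      right of the last factor to its left, where the induction hypothesis can absorb it.\<close>
    then have "row_col (rho (W_pres (x * gen g) * e0 ^ m)) * (e1T * f1T) =
        row_col (rho (W_pres x * e0 ^ g)) * (e1T * f1T) * Delta_y (Suc m)"
      by (simp add: mult.assoc[of _ "row_col _"] row_col_rho_e0_power) (simp add: mult.assoc)
    then show ?case
      by (simp add: gen Delta_pres_simps mult.assoc)
  next
    case (add x z)
    then show ?case
      by (simp add: W_pres_simps Delta_pres_simps distrib_left distrib_right rho_add[OF h] row_col_add)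
  qed
  moreover have "W_pres x * e0 ^ m * e1 = W_pres (- (x * gen m))"
    using W_pres_simps(3)[of 0 "x * gen m"] by (simp add: W_pres_mult_gen W_pres_simps(2))
  moreover have "Delta_pres (- (x * gen m)) = - Delta_pres (x * gen m)"
    using Delta_pres_simps(3)[of 0 "x * gen m"] by (simp add: Delta_pres_simps(2))
  ultimately show ?case
    by (simp add: Delta_W_W_pres)
next
  case (add a b)
  then show ?case
    by (simp add: rho_add[OF h] row_col_add distrib_left distrib_right
        Delta_W_hom(1)[OF mult_e1_in_range_W_pres mult_e1_in_range_W_pres])
qed

end

section \<open>Degrees, the tensor square of W, and the localization\<close>

text \<open>A homogeneous element is a sum of monomials of its own degree, so the induction need not
  leave that degree.\<close>

lemma graded_part_induct [consumes 1, case_names zero single add]: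
  fixes x :: "'m \<Rightarrow>\<^sub>0 'k::comm_monoid_add"
  assumes x: "x \<in> graded_part d n"
    and zero: "P 0"
    and single: "\<And>m c. d m = n \<Longrightarrow> P (Poly_Mapping.single m c)"
    and add: "\<And>x z. P x \<Longrightarrow> P z \<Longrightarrow> P (x + z)"
  shows "P x"
proof -
  have "P (\<Sum>m\<in>A. Poly_Mapping.single m (Poly_Mapping.lookup x m))"
    if "finite A" "A \<subseteq> Poly_Mapping.keys x" for A
    using that x by (induction rule: finite_induct) (auto simp: graded_part_def intro: zero single add)
  moreover have "(\<Sum>m\<in>Poly_Mapping.keys x. Poly_Mapping.single m (Poly_Mapping.lookup x m)) = x"
    by (rule poly_mapping_eqI) (simp add: lookup_sum lookup_single when_def in_keys_iff)
  ultimately show ?thesis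
    by (metis finite_keys order_refl)
qed

lemma graded_part_single: "d m = n \<Longrightarrow> Poly_Mapping.single m c \<in> graded_part d n"
  by (simp add: graded_part_def)

lemma graded_part_zero: "0 \<in> graded_part d n"
  by (simp add: graded_part_def)

lemma graded_part_add: "x \<in> graded_part d n \<Longrightarrow> z \<in> graded_part d n \<Longrightarrow> x + z \<in> graded_part d n"
  using Poly_Mapping.keys_add[of x z] by (auto simp: graded_part_def)

lemma graded_part_diff:
  "x \<in> graded_part d n \<Longrightarrow> z \<in> graded_part d n \<Longrightarrow> x - z \<in> graded_part d n"
  by (auto simp: graded_part_def in_keys_iff lookup_minus)

lemma graded_part_kscale: "x \<in> graded_part d n \<Longrightarrow> kscale c x \<in> graded_part d n"
  by (auto simp: graded_part_def in_keys_iff lookup_kscale)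

lemma graded_part_mult:
  fixes x z :: "'m::monoid_add \<Rightarrow>\<^sub>0 'k::comm_ring_1"
  assumes "\<And>u v. d (u + v) = d u + d v" "x \<in> graded_part d p" "z \<in> graded_part d q"
  shows "x * z \<in> graded_part d (p + q)"
  using assms(2)
proof (induction rule: graded_part_induct)
  case (single u c)
  from assms(3) show ?case
    by (induction rule: graded_part_induct)
      (auto simp: single assms(1) mult_single distrib_left intro: graded_part_zero graded_part_add graded_part_single)
qed (auto simp: distrib_right intro: graded_part_zero graded_part_add)

text \<open>An injective translation of the monoid only relabels coefficients. This and its mirror
  image allow cancelling \<open>e1\<close> and \<open>e1T * f1T\<close> in degree arguments.\<close>

lemma lookup_single_mult_cancel:
  fixes x :: "'m::monoid_add \<Rightarrow>\<^sub>0 'k::comm_ring_1"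
  assumes "inj ((+) u)"
  shows "Poly_Mapping.lookup (Poly_Mapping.single u 1 * x) (u + m) = Poly_Mapping.lookup x m"
  by (induction x rule: pm_induct)
    (use injD[OF assms] in \<open>auto simp: mult_single lookup_single when_def distrib_left lookup_add\<close>)

lemma lookup_mult_single_cancel:
  fixes x :: "'m::monoid_add \<Rightarrow>\<^sub>0 'k::comm_ring_1"
  assumes "inj (\<lambda>m. m + u)"
  shows "Poly_Mapping.lookup (x * Poly_Mapping.single u 1) (m + u) = Poly_Mapping.lookup x m"
  by (induction x rule: pm_induct)
    (use injD[OF assms] in \<open>auto simp: mult_single lookup_single when_def distrib_right lookup_add\<close>)

lemma deg_word_add: "deg_word (u + v) = deg_word u + deg_word v"
  by (simp add: deg_word_def plus_word_def)

lemma deg_word2_add: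
  "(case p + q of (u, v) \<Rightarrow> deg_word u + deg_word v) =
    (case p of (u, v) \<Rightarrow> deg_word u + deg_word v) + (case q of (u, v) \<Rightarrow> deg_word u + deg_word v)"
  by (cases p; cases q) (simp add: deg_word_add)

lemma deg_loc_add: "deg_loc (u + v) = deg_loc u + deg_loc v"
  by transfer (simp add: plus_word_def)

lemma deg_loc2_add:
  "(case p + q of (u, v) \<Rightarrow> deg_loc u + deg_loc v) =
    (case p of (u, v) \<Rightarrow> deg_loc u + deg_loc v) + (case q of (u, v) \<Rightarrow> deg_loc u + deg_loc v)"
  by (cases p; cases q) (simp add: deg_loc_add)

lemma V_part_mult: "x \<in> V_part p \<Longrightarrow> z \<in> V_part q \<Longrightarrow> x * z \<in> V_part (p + q)"
  unfolding V_part_def by (rule graded_part_mult[OF deg_word_add])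

lemma V2_part_mult: "x \<in> V2_part p \<Longrightarrow> z \<in> V2_part q \<Longrightarrow> x * z \<in> V2_part (p + q)"
  unfolding V2_part_def by (rule graded_part_mult[OF deg_word2_add])

lemma V2_part_closed:
  "0 \<in> V2_part n" "x \<in> V2_part n \<Longrightarrow> z \<in> V2_part n \<Longrightarrow> x + z \<in> V2_part n"
  "x \<in> V2_part n \<Longrightarrow> z \<in> V2_part n \<Longrightarrow> x - z \<in> V2_part n" "x \<in> V2_part n \<Longrightarrow> - x \<in> V2_part n"
  using graded_part_diff[OF graded_part_zero, of x]
  by (auto simp: V2_part_def intro: graded_part_zero graded_part_add graded_part_diff)

lemma gens_V_part: "e0 \<in> V_part 1" "e1 \<in> V_part 1"
  by (simp_all add: V_part_def e0_def e1_def gen_def graded_part_single deg_word_def)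

lemma gens_T_single:
  "e0T = Poly_Mapping.single (Word [X0], 0) 1" "e1T = Poly_Mapping.single (Word [X1], 0) 1"
  "f0T = Poly_Mapping.single (0, Word [X0]) 1" "f1T = Poly_Mapping.single (0, Word [X1]) 1"
  by (simp_all add: e0T_def e1T_def f0T_def f1T_def e0_def e1_def gen_def tensor_single flip: single_one)

lemma gens_T_V2_part: "e0T \<in> V2_part 1" "e1T \<in> V2_part 1" "f0T \<in> V2_part 1" "f1T \<in> V2_part 1"
  by (simp_all add: V2_part_def gens_T_single graded_part_single deg_word_def zero_word_def)

lemma row_col_V2_part:
  assumes "X \<in> M3_part n"
  shows "row_col X \<in> V2_part (n + 1)"
proof -
  have "row_col X \<in> V2_part (1 + n)"
    unfolding row_col_expand
    by (intro V2_part_closed V2_part_mult gens_T_V2_part) (use assms in \<open>auto simp: M3_part_def\<close>)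
  then show ?thesis by (simp add: add.commute)
qed

lemma M3_part_mult:
  assumes "X \<in> M3_part p" "Y \<in> M3_part q"
  shows "X ** Y \<in> M3_part (p + q)"
  using assms
  by (auto simp: M3_part_def matrix_matrix_mult_def sum_3 intro!: V2_part_closed(1,2) intro: V2_part_mult)

lemma M3_part_kscale: "X \<in> M3_part n \<Longrightarrow> M3_scale c X \<in> M3_part n"
  by (simp add: M3_part_def M3_scale_def map_matrix_def V2_part_def graded_part_kscale)

section \<open>Products in tensor squares and the values of the coproduct\<close>

lemma span_kscale_mult_closed:
  fixes S :: "('m::monoid_add \<Rightarrow>\<^sub>0 'k::comm_ring_1) set"
  assumes S: "\<And>x z. x \<in> S \<Longrightarrow> z \<in> S \<Longrightarrow> x * z \<in> S"
    and x: "x \<in> module.span kscale S" and z: "z \<in> module.span kscale S"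
  shows "x * z \<in> module.span kscale S"
proof -
  interpret module "kscale :: 'k \<Rightarrow> ('m \<Rightarrow>\<^sub>0 'k) \<Rightarrow> _" by (rule module_kscale)
  have "s * z \<in> span S" if "s \<in> S" for s
    using z by (induction rule: span_induct_alt)
      (auto simp: distrib_left kscale_mult_right intro: span_zero span_base S that intro!: span_add span_scale)
  with x show ?thesis
    by (induction rule: span_induct_alt)
      (auto simp: distrib_right kscale_mult_left intro: span_zero intro!: span_add span_scale)
qed

lemma tensor_square_mult:
  fixes S :: "('m::monoid_add \<Rightarrow>\<^sub>0 'k::comm_ring_1) set"
  assumes "\<And>x z. x \<in> S \<Longrightarrow> z \<in> S \<Longrightarrow> x * z \<in> S" "x \<in> tensor_square S" "z \<in> tensor_square S"
  shows "x * z \<in> tensor_square S"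
proof -
  have "p * q \<in> {x \<otimes>\<^sub>t y |x y. x \<in> S \<and> y \<in> S}"
    if "p \<in> {x \<otimes>\<^sub>t y |x y. x \<in> S \<and> y \<in> S}" "q \<in> {x \<otimes>\<^sub>t y |x y. x \<in> S \<and> y \<in> S}" for p q
    using that assms(1) by (auto simp: tensor_mult) blast
  from span_kscale_mult_closed[OF this] assms(2,3) show ?thesis
    unfolding tensor_square_def by blast
qed

lemma tensor_square_closed:
  "0 \<in> tensor_square S" "x \<in> tensor_square S \<Longrightarrow> z \<in> tensor_square S \<Longrightarrow> x + z \<in> tensor_square S"
  "x \<in> tensor_square S \<Longrightarrow> z \<in> tensor_square S \<Longrightarrow> x - z \<in> tensor_square S"
  "x \<in> tensor_square S \<Longrightarrow> kscale c x \<in> tensor_square S"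
  "u \<in> S \<Longrightarrow> v \<in> S \<Longrightarrow> u \<otimes>\<^sub>t v \<in> tensor_square S"
  unfolding tensor_square_def
  by (rule module.span_zero module.span_add module.span_diff module.span_scale module.span_base,
      rule module_kscale; blast)+

lemma W_mult: "x \<in> W \<Longrightarrow> z \<in> W \<Longrightarrow> x * z \<in> W"
proof -
  assume "x \<in> W" "z \<in> W"
  then obtain c v d w where "x = kscale c 1 + v * e1" "z = kscale d 1 + w * e1"
    by (auto simp: W_def)
  then have "x * z = kscale (c * d) 1 + (kscale d v + (kscale c 1 + v * e1) * w) * e1"
    by (simp add: distrib_left distrib_right kscale_mult_left kscale_mult_right mult.assoc
        module.scale_scale[OF module_kscale] module.scale_right_distrib[OF module_kscale]
        mult.commute[of d])
  then show ?thesis unfolding W_def by blast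
qed

lemma W_mem: "1 \<in> W" "v * e1 \<in> W" "y_W n \<in> W"
proof -
  have "1 = kscale 1 1 + 0 * e1"
    by (simp add: module.scale_one[OF module_kscale])
  then show "1 \<in> W" unfolding W_def by blast
  have "v * e1 = kscale 0 1 + v * e1"
    by (simp add: module.scale_zero_left[OF module_kscale])
  then show "v * e1 \<in> W" unfolding W_def by blast
  have "y_W n = kscale 0 1 + (- (e0 ^ (n - 1))) * e1"
    by (simp add: y_W_def module.scale_zero_left[OF module_kscale])
  then show "y_W n \<in> W" unfolding W_def by blast
qed

lemma sum_tensor_square: "(\<And>k. k \<in> A \<Longrightarrow> f k \<in> tensor_square S) \<Longrightarrow> sum f A \<in> tensor_square S"
  by (induction A rule: infinite_finite_induct) (auto intro: tensor_square_closed)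

lemma Delta_pres_W2: "Delta_pres x \<in> W2"
proof (induction x rule: free_algebra_induct)
  case (scalar c)
  show ?case
    using tensor_square_closed(5)[OF W_mem(1) W_mem(1)]
    by (auto simp: Delta_pres_simps W2_def tensor_one intro: tensor_square_closed)
next
  case (gen x m)
  have "Delta_y (Suc m) \<in> W2"
    unfolding W2_def Delta_y_def
    by (intro tensor_square_closed sum_tensor_square W_mem)
  with gen show ?case
    unfolding Delta_pres_simps W2_def by (intro tensor_square_mult W_mult)
next
  case (add x z)
  then show ?case
    by (simp add: Delta_pres_simps W2_def tensor_square_closed)
qed

lemma Delta_W_W2:
  assumes "x \<in> W_plus"
  shows "Delta_W x \<in> W2"
proof -
  obtain y where "x = W_pres y"
    using assms W_plus_subset_range_W_pres by blast
  then show ?thesis by (simp add: Delta_W_W_pres Delta_pres_W2)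
qed

text \<open>The monoid morphism underlying \<open>incl\<close>: basis words go to basis words, and
  degrees are preserved.\<close>

definition loc_of :: "letter word \<Rightarrow> loc_word" where
  "loc_of w = abs_loc_word (Word (map (\<lambda>x. case x of X0 \<Rightarrow> L0 | X1 \<Rightarrow> L1) (letters w)))"

lemma loc_of_add: "loc_of (u + v) = loc_of u + loc_of v"
  by (simp add: loc_of_def plus_word_def plus_loc_word.abs_eq)

lemma loc_of_zero: "loc_of 0 = 0"
  by (simp add: loc_of_def zero_word_def zero_loc_word_def)

lemma deg_loc_loc_of: "deg_loc (loc_of w) = deg_word w"
proof -
  have "sum_list (map (deg_loc_letter \<circ> (\<lambda>x. case x of X0 \<Rightarrow> L0 | X1 \<Rightarrow> L1)) l) = int (length l)" for l
    by (induction l) (auto split: letter.split)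
  then show ?thesis
    by (simp add: loc_of_def deg_loc.abs_eq deg_word_def)
qed

lemma incl_single:
  fixes c :: "'k::comm_ring_1"
  shows "incl (Poly_Mapping.single w c) = Poly_Mapping.single (loc_of w) c"
proof -
  have "prod_list (map (\<lambda>x. case x of X0 \<Rightarrow> loc_gen L0 | X1 \<Rightarrow> loc_gen L1) l) =
      (Poly_Mapping.single (loc_of (Word l)) 1 :: 'k Vloc)" for l
  proof (induction l)
    case Nil
    show ?case using loc_of_zero by (simp add: zero_word_def)
  next
    case (Cons a l)
    have "loc_of (Word (a # l)) = loc_of (Word [a]) + loc_of (Word l)"
      by (simp add: plus_word_def flip: loc_of_add)
    with Cons show ?case
      by (simp add: loc_gen_def mult_single) (simp add: loc_of_def loc_gen_def mult_single split: letter.split)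
  qed
  then show ?thesis
    by (cases w) (simp add: incl_def free_lift_def module.linear_lift_single[OF module_kscale] kscale_single)
qed

lemma incl2_single:
  "incl2 (Poly_Mapping.single (u, v) c) = Poly_Mapping.single (loc_of u, loc_of v) c"
  by (simp add: incl2_def tensor_map_def module.linear_lift_single[OF module_kscale] incl_single
      tensor_single kscale_single)

lemma incl2_add: "incl2 (x + z) = incl2 x + incl2 z"
  by (simp add: incl2_def tensor_map_def module.linear_lift_add[OF module_kscale])

lemma incl2_zero: "incl2 0 = 0"
  by (simp add: incl2_def tensor_map_def module.linear_lift_zero[OF module_kscale])

lemma incl2_diff: "incl2 (x - z) = incl2 x - incl2 z"
  by (metis add_diff_cancel diff_add_cancel incl2_add)

lemma incl2_kscale: "incl2 (kscale c x) = kscale c (incl2 x)"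
  by (simp add: incl2_def tensor_map_def module.linear_lift_kscale[OF module_kscale])

lemma incl2_mult: "incl2 (x * z) = incl2 x * incl2 z"
  unfolding incl2_def tensor_map_def
  by (rule kscale_algebra.linear_lift_mult)
    (auto simp: incl_single tensor_single mult_single loc_of_add)

lemma incl2_one: "incl2 1 = 1"
  using incl2_single[of 0 0 1] by (simp add: loc_of_zero flip: zero_prod_def)

lemma loc_gen_inverse: "loc_gen L1inv * loc_gen L1 = 1" "loc_gen L1 * loc_gen L1inv = 1"
  by (simp_all add: loc_gen_def mult_single plus_loc_word.abs_eq plus_word_def
      loc_word.abs_eq_iff[THEN iffD2, OF loc_left_inv] loc_word.abs_eq_iff[THEN iffD2, OF loc_right_inv]
      flip: zero_loc_word_def)

lemma incl2_gens: "incl2 e1T = loc_gen L1 \<otimes>\<^sub>t 1" "incl2 f1T = 1 \<otimes>\<^sub>t loc_gen L1"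
  by (simp_all add: gens_T_single incl2_single loc_of_zero)
    (simp_all add: loc_of_def loc_gen_def tensor_single flip: single_one)

lemma inv_e1f1_cancel: "inv_e1f1 * incl2 (e1T * f1T) = 1"
  by (simp add: inv_e1f1_def incl2_mult incl2_gens tensor_mult loc_gen_inverse tensor_one)

lemma Vloc_ge0_2_single:
  assumes "deg_loc u \<ge> 0" "deg_loc v \<ge> 0"
  shows "Poly_Mapping.single (u, v) c \<in> Vloc_ge0_2"
proof -
  have "Poly_Mapping.single (u, v) c = Poly_Mapping.single u c \<otimes>\<^sub>t Poly_Mapping.single v 1"
    by (simp add: tensor_single)
  also have "\<dots> \<in> Vloc_ge0_2"
    using assms unfolding Vloc_ge0_2_def by (intro tensor_square_closed) (auto simp: Vloc_ge0_def)
  finally show ?thesis .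
qed

lemmas Vloc_ge0_2_closed = tensor_square_closed[where S = Vloc_ge0, folded Vloc_ge0_2_def]

lemma incl2_Vloc_ge0_2: "incl2 x \<in> Vloc_ge0_2"
  by (induction x rule: pm_induct)
    (auto simp: incl2_zero incl2_add incl2_single deg_loc_loc_of deg_word_def
      intro!: Vloc_ge0_2_closed Vloc_ge0_2_single)

lemma incl2_graded:
  "x \<in> V2_part n \<Longrightarrow> incl2 x \<in> graded_part (\<lambda>(u, v). deg_loc u + deg_loc v) n"
  unfolding V2_part_def
  by (induction rule: graded_part_induct)
    (auto simp: incl2_zero incl2_add incl2_single deg_loc_loc_of
      intro!: graded_part_zero graded_part_add graded_part_single)

lemma sandwich_row_col: "sandwich X = inv_e1f1 * incl2 (row_col X) * incl2 (e1T * f1T)"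
  by (simp add: sandwich_def row_col_def)

text \<open>On a monomial, each tensor factor receives one \<open>L1inv\<close> on the left and one
  \<open>L1\<close> on the right, so its degree is unchanged and stays nonnegative.\<close>

lemma conj_Vloc_ge0_2:
  "inv_e1f1 * incl2 (e1T * z) * incl2 (e1T * f1T) \<in> Vloc_ge0_2"
  "inv_e1f1 * incl2 (f1T * z) * incl2 (e1T * f1T) \<in> Vloc_ge0_2"
proof -
  have L1: "deg_loc (abs_loc_word (Word [L1])) = 1" "deg_loc (abs_loc_word (Word [L1inv])) = - 1"
    by (simp_all add: deg_loc.abs_eq)
  show "inv_e1f1 * incl2 (e1T * z) * incl2 (e1T * f1T) \<in> Vloc_ge0_2"
    "inv_e1f1 * incl2 (f1T * z) * incl2 (e1T * f1T) \<in> Vloc_ge0_2"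
    by (induction z rule: pm_induct)
      (auto simp: incl2_zero incl2_add incl2_single incl2_mult incl2_gens inv_e1f1_def distrib_left distrib_right
        loc_gen_def tensor_single mult_single deg_loc_add L1 deg_loc_loc_of deg_word_def
        simp flip: single_one
        intro!: Vloc_ge0_2_closed Vloc_ge0_2_single)
qed

lemma sandwich_Vloc_ge0_2: "sandwich X \<in> Vloc_ge0_2"
  unfolding sandwich_row_col row_col_expand incl2_diff left_diff_distrib right_diff_distrib
  by (intro Vloc_ge0_2_closed conj_Vloc_ge0_2)

lemma sandwich_graded:
  assumes "X \<in> M3_part n"
  shows "sandwich X \<in> graded_part (\<lambda>(u, v). deg_loc u + deg_loc v) (n + 1)"
proof -
  have "inv_e1f1 \<in> graded_part (\<lambda>(u, v). deg_loc u + deg_loc v) (- 2)"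
    by (simp add: inv_e1f1_def loc_gen_def tensor_single graded_part_single deg_loc.abs_eq)
  moreover have "incl2 (e1T * f1T) \<in> graded_part (\<lambda>(u, v). deg_loc u + deg_loc v) (1 + 1)"
    by (intro incl2_graded V2_part_mult gens_T_V2_part)
  \<comment> \<open>The inverse contributes -2 and \<open>e1T * f1T\<close> contributes 2; the
    remaining 1 comes from \<open>row1\<close>.\<close>
  ultimately have "sandwich X \<in> graded_part (\<lambda>(u, v). deg_loc u + deg_loc v) (- 2 + (n + 1) + (1 + 1))"
    unfolding sandwich_row_col
    by (intro graded_part_mult deg_loc2_add incl2_graded[OF row_col_V2_part[OF assms]])
  moreover have "- 2 + (n + 1) + (1 + 1) = n + 1" by simp
  ultimately show ?thesis by metis
qed

lemma sandwich_module_mor: "module_mor M3_scale kscale UNIV Vloc_ge0_2 sandwich"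
  by (auto simp: module_mor_def sandwich_Vloc_ge0_2)
    (simp_all add: sandwich_row_col row_col_add row_col_M3_scale incl2_add incl2_kscale distrib_left
      distrib_right kscale_mult_left kscale_mult_right)

text \<open>The product of the matrix units at \<open>(1, 3)\<close> and \<open>(3, 1)\<close> is the one at \<open>(1, 1)\<close>, which is
  not annihilated, whereas the first factor is annihilated by \<open>col1\<close>.\<close>

lemma sandwich_not_mult: "\<not> mult_mor (**) (*) UNIV (sandwich :: 'k::comm_ring_1 V2 ^ 3 ^ 3 \<Rightarrow> _)"
proof
  let ?X = "vector [vector [0, 0, 1], 0, 0] :: 'k V2 ^ 3 ^ 3"
  let ?Y = "vector [0, 0, vector [1, 0, 0]] :: 'k V2 ^ 3 ^ 3"
  assume "mult_mor (**) (*) UNIV (sandwich :: 'k V2 ^ 3 ^ 3 \<Rightarrow> _)"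
  then have "sandwich (?X ** ?Y) = sandwich ?X * sandwich ?Y"
    by (simp add: mult_mor_def)
  moreover have "row_col (?X ** ?Y) = e1T" "row_col ?X = 0"
    by (simp_all add: row_col_expand matrix_matrix_mult_def sum_3)
  ultimately have "inv_e1f1 * incl2 e1T * incl2 (e1T * f1T) = (0 :: 'k Vloc2)"
    by (simp add: sandwich_row_col incl2_zero)
  moreover have "inv_e1f1 * incl2 e1T * incl2 (e1T * f1T) = (loc_gen L1 \<otimes>\<^sub>t 1 :: 'k Vloc2)"
    by (simp add: inv_e1f1_def incl2_mult incl2_gens tensor_mult loc_gen_inverse)
  moreover have "Poly_Mapping.keys (loc_gen L1 \<otimes>\<^sub>t 1 :: 'k Vloc2) \<noteq> {}"
    by (simp add: loc_gen_def tensor_single flip: single_one)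
  ultimately show False by simp
qed

text \<open>At the pair \<open>(1, 1)\<close> multiplicativity would give \<open>1 = e1\<close>, but
  the constant terms differ.\<close>

lemma id_not_mult_e1: "\<not> mult_mor (*) mult_e1 UNIV (id :: 'k::comm_ring_1 V \<Rightarrow> 'k V)"
proof
  assume "mult_mor (*) mult_e1 UNIV (id :: 'k V \<Rightarrow> 'k V)"
  then have "id (1 * 1 :: 'k V) = mult_e1 (id 1) (id 1)"
    unfolding mult_mor_def by blast
  then have "1 = (e1 :: 'k V)"
    by (simp add: mult_e1_def)
  then have "Poly_Mapping.lookup (1 :: 'k V) 0 = Poly_Mapping.lookup e1 0"
    by simp
  then show False
    by (simp add: e1_def gen_def lookup_single lookup_one zero_word_def)
qed

section \<open>Cancelling e1 and e1 f1\<close>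

lemma inj_add_word: "inj ((+) u)" "inj (\<lambda>m. m + u)" for u :: "'x word"
  by (auto intro!: injI simp: plus_word_def word.expand)

lemma lookup_mult_e1: "Poly_Mapping.lookup (a * e1) (w + Word [X1]) = Poly_Mapping.lookup a w"
  unfolding e1_def gen_def by (rule lookup_mult_single_cancel) (rule inj_add_word)

lemma bij_betw_mor: "bij_betw (mor :: 'k::comm_ring_1 V \<Rightarrow> 'k V) UNIV W_plus"
proof -
  have "inj (mor :: 'k V \<Rightarrow> 'k V)"
  proof (rule injI)
    fix a b :: "'k V"
    assume "mor a = mor b"
    then show "a = b"
      by (intro poly_mapping_eqI) (metis lookup_mult_e1 mor_def)
  qed
  then show ?thesis
    by (auto simp: bij_betw_def W_plus_def mor_def)
qed

lemma V_part_mult_e1D: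
  assumes "a * e1 \<in> V_part n"
  shows "a \<in> V_part (n - 1)"
  unfolding V_part_def graded_part_def
proof clarify
  fix w assume "w \<in> Poly_Mapping.keys a"
  then have "w + Word [X1] \<in> Poly_Mapping.keys (a * e1)"
    by (simp add: in_keys_iff lookup_mult_e1)
  with assms have "deg_word (w + Word [X1]) = n"
    by (auto simp: V_part_def graded_part_def)
  then show "deg_word w = n - 1"
    by (simp add: deg_word_def plus_word_def)
qed

lemma V2_part_e1T_f1T_D:
  assumes "e1T * f1T * z \<in> V2_part (n + 2)"
  shows "z \<in> V2_part n"
  unfolding V2_part_def graded_part_def
proof clarify
  fix u v assume uv: "(u, v) \<in> Poly_Mapping.keys z"
  have "inj ((+) (Word [X1], Word [X1]))"
    by (auto intro!: injI simp: plus_word_def word.expand)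
  from lookup_single_mult_cancel[OF this, of z "(u, v)"]
  have "Poly_Mapping.lookup (e1T * f1T * z) (Word [X1] + u, Word [X1] + v) = Poly_Mapping.lookup z (u, v)"
    by (simp add: gens_T_single mult_single)
  with uv have "(Word [X1] + u, Word [X1] + v) \<in> Poly_Mapping.keys (e1T * f1T * z)"
    by (simp add: in_keys_iff)
  with assms have "deg_word (Word [X1] + u) + deg_word (Word [X1] + v) = n + 2"
    by (auto simp: V2_part_def graded_part_def)
  then show "deg_word u + deg_word v = n"
    by (simp add: deg_word_def plus_word_def)
qed

context
  fixes h :: "rat \<Rightarrow> 'k::comm_ring_1"
  assumes h: "rat_algebra_map h"
begin

text \<open>\<open>rho\<close> is multiplicative and its values at both generators have entries of
  degree 1, so the degree of a monomial is its length.\<close>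

lemma rho_M3_part:
  fixes a :: "'k V"
  assumes "a \<in> V_part n"
  shows "rho a \<in> M3_part n"
  using assms unfolding V_part_def
proof (induction rule: graded_part_induct)
  case zero
  show ?case using rho_add[OF h, of 0 0] by (simp add: M3_part_def V2_part_closed)
next
  case (single w c)
  have e0: "rho (e0 :: 'k V) \<in> M3_part 1"
    by (auto simp: rho_e0[OF h] M3_part_def forall_3 gens_T_V2_part
      intro!: V2_part_closed gens_T_V2_part)
  have e1: "rho (e1 :: 'k V) \<in> M3_part 1"
    by (auto simp: rho_e1[OF h] M3_part_def forall_3 matrix_matrix_mult_def col1_def row1_def
      intro!: V2_part_closed gens_T_V2_part)
  have "rho (Poly_Mapping.single (Word l) c) \<in> M3_part (int (length l))" for l
  proof (induction l rule: rev_induct)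
    case Nil
    have "Poly_Mapping.single (Word []) c = (kscale c 1 :: 'k V)"
      by (simp add: kscale_single zero_word_def flip: single_one)
    then have "rho (Poly_Mapping.single (Word []) c) = M3_scale c (mat 1)"
      by (simp only: rho_kscale[OF h] rho_one[OF h])
    moreover have "mat 1 \<in> (M3_part 0 :: ('k V2 ^ 3 ^ 3) set)"
      by (auto simp: M3_part_def mat_def V2_part_def graded_part_def deg_word_def zero_word_def zero_prod_def)
    ultimately show ?case by (simp add: M3_part_kscale)
  next
    case (snoc g l)
    have "Poly_Mapping.single (Word (l @ [g])) c = Poly_Mapping.single (Word l) c * gen g"
      by (simp add: gen_def mult_single plus_word_def)
    moreover have "rho (gen g :: 'k V) \<in> M3_part 1"
      using e0 e1 by (cases g) (simp_all add: e0_def e1_def)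
    ultimately show ?case
      using M3_part_mult[OF snoc] by (simp add: rho_mult[OF h] add.commute)
  qed
  from this[of "letters w"] single show ?case
    by (simp add: deg_word_def)
next
  case (add x z)
  then show ?case by (simp add: rho_add[OF h] M3_part_def V2_part_closed)
qed

text \<open>The degree of the coproduct is deduced from the identity already proved: the side with
  \<open>rho\<close> is homogeneous of degree \<open>n + 2\<close>, and cancelling
  \<open>e1T * f1T\<close> lowers this by 2.\<close>

lemma Delta_W_V2_part:
  fixes a :: "'k V"
  assumes "a * e1 \<in> V_part n"
  shows "Delta_W (a * e1) \<in> V2_part n"
proof -
  have "row_col (rho a) \<in> V2_part n"
    using row_col_V2_part[OF rho_M3_part[OF V_part_mult_e1D[OF assms]]] by simp
  then have "row_col (rho a) * (e1T * f1T) \<in> V2_part (n + (1 + 1))"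
    by (intro V2_part_mult gens_T_V2_part)
  then have "e1T * f1T * Delta_W (a * e1) \<in> V2_part (n + 2)"
    by (simp add: row_col_rho_e1_f1[OF h])
  then show ?thesis by (rule V2_part_e1T_f1T_D)
qed

text \<open>\<open>incl2\<close> carries \<open>row_col_rho_e1_f1\<close> to the localization, where
  the left factor \<open>e1T * f1T\<close> becomes invertible and cancels.\<close>

lemma sandwich_rho: "sandwich (rho (a :: 'k V)) = incl2 (Delta_W (a * e1))"
proof -
  have "sandwich (rho a) = inv_e1f1 * incl2 (e1T * f1T) * incl2 (Delta_W (a * e1))"
    by (simp add: sandwich_row_col mult.assoc row_col_rho_e1_f1[OF h] flip: incl2_mult)
  then show ?thesis by (simp add: inv_e1f1_cancel)
qed

end

theorem proposition6p3:
  fixes h :: "rat \<Rightarrow> 'k::comm_ring_1"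
  assumes "rat_algebra_map h"
  shows
    "\<comment> \<open>the equality, both sides of which lie in the tensor square of the part of degree \<open>\<ge> 0\<close>\<close>
     (\<forall>a :: 'k V.
       incl2 (Delta_W (a * e1)) =
         inv_e1f1 * incl2 ((row1 ** rho a ** col1) $ 1 $ 1) * incl2 (e1T * f1T) \<and>
       Delta_W (a * e1) \<in> W2 \<and>
       incl2 (Delta_W (a * e1)) \<in> Vloc_ge0_2) \<and>
     \<comment> \<open>commutativity of the diagram\<close>
     (sandwich :: 'k V2 ^ 3 ^ 3 \<Rightarrow> 'k Vloc2) \<circ> rho = incl2 \<circ> Delta_W \<circ> mor \<circ> id \<and>
     \<comment> \<open>the algebra morphisms\<close>
     alg_mor kscale (*) M3_scale (**) UNIV UNIV (rho :: 'k V \<Rightarrow> 'k V2 ^ 3 ^ 3) \<and>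
     rho (1 :: 'k V) = mat 1 \<and>
     alg_mor kscale mult_e1 kscale (*) UNIV W_plus (mor :: 'k V \<Rightarrow> 'k V) \<and>
     alg_mor kscale (*) kscale (*) W_plus W2 (Delta_W :: 'k V \<Rightarrow> 'k V2) \<and>
     alg_mor kscale (*) kscale (*) W2 Vloc_ge0_2 (incl2 :: 'k V2 \<Rightarrow> 'k Vloc2) \<and>
     incl2 (1 :: 'k V2) = 1 \<and>
     \<comment> \<open>the two maps that are only module morphisms\<close>
     module_mor kscale kscale UNIV UNIV (id :: 'k V \<Rightarrow> 'k V) \<and>
     \<not> alg_mor kscale (*) kscale mult_e1 UNIV UNIV (id :: 'k V \<Rightarrow> 'k V) \<and>
     module_mor M3_scale kscale UNIV Vloc_ge0_2 (sandwich :: 'k V2 ^ 3 ^ 3 \<Rightarrow> 'k Vloc2) \<and>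
     \<not> alg_mor M3_scale (**) kscale (*) UNIV Vloc_ge0_2 (sandwich :: 'k V2 ^ 3 ^ 3 \<Rightarrow> 'k Vloc2) \<and>
     \<comment> \<open>\<open>mor\<close> is an isomorphism\<close>
     bij_betw (mor :: 'k V \<Rightarrow> 'k V) UNIV W_plus \<and>
     \<comment> \<open>degrees\<close>
     has_degree 0 V_part M3_part (rho :: 'k V \<Rightarrow> 'k V2 ^ 3 ^ 3) \<and>
     has_degree 0 V_part V_part (id :: 'k V \<Rightarrow> 'k V) \<and>
     has_degree 1 V_part (\<lambda>n. W_plus \<inter> V_part n) (mor :: 'k V \<Rightarrow> 'k V) \<and>
     has_degree 0 (\<lambda>n. W_plus \<inter> V_part n) (\<lambda>n. W2 \<inter> V2_part n) (Delta_W :: 'k V \<Rightarrow> 'k V2) \<and>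
     has_degree 0 (\<lambda>n. W2 \<inter> V2_part n) Vloc_ge0_2_part (incl2 :: 'k V2 \<Rightarrow> 'k Vloc2) \<and>
     has_degree 1 M3_part Vloc_ge0_2_part (sandwich :: 'k V2 ^ 3 ^ 3 \<Rightarrow> 'k Vloc2)"
proof (intro conjI allI)
  fix a :: "'k V"
  show "incl2 (Delta_W (a * e1)) =
      inv_e1f1 * incl2 ((row1 ** rho a ** col1) $ 1 $ 1) * incl2 (e1T * f1T)"
    using sandwich_rho[OF assms, of a] by (simp add: sandwich_def)
  show "Delta_W (a * e1) \<in> W2"
    by (rule Delta_W_W2) (auto simp: W_plus_def)
  show "incl2 (Delta_W (a * e1)) \<in> Vloc_ge0_2"
    by (rule incl2_Vloc_ge0_2)
next
  show "(sandwich :: 'k V2 ^ 3 ^ 3 \<Rightarrow> 'k Vloc2) \<circ> rho = incl2 \<circ> Delta_W \<circ> mor \<circ> id"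
    by (simp add: fun_eq_iff mor_def sandwich_rho[OF assms])
  show "alg_mor kscale (*) M3_scale (**) UNIV UNIV (rho :: 'k V \<Rightarrow> 'k V2 ^ 3 ^ 3)"
    by (simp add: alg_mor_def module_mor_def mult_mor_def rho_add[OF assms] rho_mult[OF assms]
        rho_kscale[OF assms])
  show "rho (1 :: 'k V) = mat 1"
    by (rule rho_one[OF assms])
  show "alg_mor kscale mult_e1 kscale (*) UNIV W_plus (mor :: 'k V \<Rightarrow> 'k V)"
    by (auto simp: alg_mor_def module_mor_def mult_mor_def mor_def mult_e1_def W_plus_def
        distrib_right kscale_mult_left mult.assoc)
  show "alg_mor kscale (*) kscale (*) W_plus W2 (Delta_W :: 'k V \<Rightarrow> 'k V2)"
    using W_plus_subset_range_W_pres[where 'a='k]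
    by (auto simp: alg_mor_def module_mor_def mult_mor_def Delta_W_W2 Delta_W_hom Delta_W_kscale subset_iff)
  show "alg_mor kscale (*) kscale (*) W2 Vloc_ge0_2 (incl2 :: 'k V2 \<Rightarrow> 'k Vloc2)"
    by (auto simp: alg_mor_def module_mor_def mult_mor_def incl2_Vloc_ge0_2 incl2_add incl2_mult
        incl2_kscale)
  show "incl2 (1 :: 'k V2) = 1"
    by (rule incl2_one)
  show "module_mor kscale kscale UNIV UNIV (id :: 'k V \<Rightarrow> 'k V)"
    by (simp add: module_mor_def)
  show "\<not> alg_mor kscale (*) kscale mult_e1 UNIV UNIV (id :: 'k V \<Rightarrow> 'k V)"
    using id_not_mult_e1[where 'k = 'k] by (simp add: alg_mor_def)
  show "module_mor M3_scale kscale UNIV Vloc_ge0_2 (sandwich :: 'k V2 ^ 3 ^ 3 \<Rightarrow> 'k Vloc2)"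
    by (rule sandwich_module_mor)
  show "\<not> alg_mor M3_scale (**) kscale (*) UNIV Vloc_ge0_2 (sandwich :: 'k V2 ^ 3 ^ 3 \<Rightarrow> 'k Vloc2)"
    using sandwich_not_mult[where 'k = 'k] by (simp add: alg_mor_def)
  show "bij_betw (mor :: 'k V \<Rightarrow> 'k V) UNIV W_plus"
    by (rule bij_betw_mor)
  show "has_degree 0 V_part M3_part (rho :: 'k V \<Rightarrow> 'k V2 ^ 3 ^ 3)"
    using rho_M3_part[OF assms] by (auto simp: has_degree_def)
  show "has_degree 0 V_part V_part (id :: 'k V \<Rightarrow> 'k V)"
    by (simp add: has_degree_def)
  show "has_degree 1 V_part (\<lambda>n. W_plus \<inter> V_part n) (mor :: 'k V \<Rightarrow> 'k V)"
    using V_part_mult[OF _ gens_V_part(2)] by (auto simp: has_degree_def mor_def W_plus_def)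
  show "has_degree 0 (\<lambda>n. W_plus \<inter> V_part n) (\<lambda>n. W2 \<inter> V2_part n) (Delta_W :: 'k V \<Rightarrow> 'k V2)"
    using Delta_W_V2_part[OF assms] Delta_W_W2 by (auto simp: has_degree_def W_plus_def)
  show "has_degree 0 (\<lambda>n. W2 \<inter> V2_part n) Vloc_ge0_2_part (incl2 :: 'k V2 \<Rightarrow> 'k Vloc2)"
    by (auto simp: has_degree_def Vloc_ge0_2_part_def incl2_Vloc_ge0_2 incl2_graded)
  show "has_degree 1 M3_part Vloc_ge0_2_part (sandwich :: 'k V2 ^ 3 ^ 3 \<Rightarrow> 'k Vloc2)"
    by (auto simp: has_degree_def Vloc_ge0_2_part_def sandwich_Vloc_ge0_2 sandwich_graded)
qed

end
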